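(* Let $(X,d,\mu)$ be a metric measure space with doubling measure $\mu$ (as described in the context). Let $1<q<p<\infty$ and $0<s<1$. Suppose that a nonempty closed set $E\subset X$ satisfies the upper Aikawa condition with exponent $\alpha=sq$. Then there exists a constant $C>0$ such that the following holds for every $z\in E$ and every $r$ with $0<r<\operatorname{diam}(E)$ if $\operatorname{diam}(E)>0$, or $0<r<\operatorname{diam}(X)$ if $\operatorname{diam}(E)=0$ (in particular $C$ is independent of $z$ and $r$). Let $F$ be the truncation of $E$ associated with $B(z,r)$, as defined in the context. Then $$\int_{B(z,8r)\setminus F}\frac{|u(x)|^p}{\operatorname{dist}(x,F)^{sp}}\,dx\le C\int_{B(z,8r)}\int_{B(z,8r)}\frac{|u(x)-u(y)|^p}{d(x,y)^{sp}\,\mu(B(x,d(x,y)))}\,dy\,dx$$ for all Lipschitz functions $u:X\to\mathbb R$ such that $u=0$ in $F$.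
   Context: Setting. $X=(X,d,\mu)$ is a metric measure space with at least two points, where $\mu$ is a Borel measure supported on $X$ such that $0<\mu(B)<\infty$ for all open balls $B=B(x,r)=\{y\in X: d(x,y)<r\}$, $x\in X$, $r>0$. The measure $\mu$ is doubling: there is a constant $c_\mu>1$ such that $\mu(B(x,2r))\le c_\mu\,\mu(B(x,r))$ for all $x\in X$ and $r>0$. Write $dx=d\mu(x)$, $dy=d\mu(y)$. $\operatorname{dist}(x,E)=\inf\{d(x,y):y\in E\}$ for nonempty $E$. $\mathbf 1_K$ is the characteristic function of $K$, and $\overline A$ denotes the closure of $A$. Diameters may be infinite. In the double integral, the integrand is interpreted as $0$ when $x=y$; integrals may be $+\infty$. Upper Aikawa condition. Let $E\subset X$ be nonempty and $\alpha>0$. $E$ satisfies the upper Aikawa condition with exponent $\alpha$ if for every $\varepsilon>0$ there exists $\delta>0$ such that $$\frac{1}{\mu(B(z,R))}\int_{B(z,R)}\frac{\mathbf 1_K(y)}{\operatorname{dist}(y,E)^\alpha}\,dy\ \ge\ \frac{R^{-\alpha}}{\varepsilon}$$ whenever $z\in E$, $0<R<\operatorname{diam}(E)$ and $K\subset X$ is a Borel set with $\mu(B(z,R)\setminus K)\le\delta\,\mu(B(z,R))$. If $\operatorname{diam}(E)=0$, the restriction $R<\operatorname{diam}(E)$ is replaced with $R<\operatorname{diam}(X)$. The integrand takes values in $[0,\infty]$: it equals $+\infty$ at points $y\in K$ with $\operatorname{dist}(y,E)=0$, and $0$ at points $y\notin K$. Truncation of $E$ associated with $B(z,r)$. For a closed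 set $E\subset X$, $z\in E$ and $r>0$, let $F_0=E\cap\overline{B(z,r/2)}$ and recursively $$F_j=\bigcup_{x\in F_{j-1}}E\cap\overline{B(x,2^{-j-1}r)},\qquad j=1,2,3,\dots,$$ where $\overline{B}$ denotes the closure of the open ball $B$. Set $F=\overline{\bigcup_{j\ge0}F_j}$. (One has $z\in F\subset E\cap\overline{B(z,r)}$.) *)

theory Defs
  imports "HOL-Analysis.Analysis"
begin

definition metric_measure_space :: "'a::metric_space measure \<Rightarrow> bool" where
  "metric_measure_space \<mu> \<longleftrightarrow>
     (\<exists>x y :: 'a. x \<noteq> y) \<and>
     sets \<mu> = sets borel \<and>
     (\<forall>x r. 0 < r \<longrightarrow> 0 < emeasure \<mu> (ball x r) \<and> emeasure \<mu> (ball x r) < \<infinity>)"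

definition doubling :: "'a::metric_space measure \<Rightarrow> bool" where
  "doubling \<mu> \<longleftrightarrow>
     (\<exists>c::real. c > 1 \<and>
        (\<forall>x r. 0 < r \<longrightarrow> emeasure \<mu> (ball x (2 * r)) \<le> ennreal c * emeasure \<mu> (ball x r)))"

text \<open>The diameter as an extended number: unlike \<^const>\<open>diameter\<close>, it is \<open>\<infinity>\<close> for unbounded sets.\<close>

definition ediam :: "'a::metric_space set \<Rightarrow> ennreal" where
  "ediam E = (SUP x\<in>E. SUP y\<in>E. ennreal (dist x y))"

definition admissible_radius :: "'a::metric_space set \<Rightarrow> real \<Rightarrow> bool" where
  "admissible_radius E r \<longleftrightarrow>
     0 < r \<and> ennreal r < (if ediam E = 0 then ediam (UNIV :: 'a set) else ediam E)"

text \<open>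
  The weight \<open>dist(y,E)\<^sup>-\<^sup>\<alpha>\<close> is written as an \<^typ>\<open>ennreal\<close> inverse, so that (for \<open>\<alpha> > 0\<close>) it
  is \<open>\<infinity>\<close> where \<open>dist(y,E) = 0\<close>; moreover \<open>0 * \<infinity> = 0\<close> off \<open>K\<close>.
\<close>

definition upper_Aikawa :: "'a::metric_space measure \<Rightarrow> 'a set \<Rightarrow> real \<Rightarrow> bool" where
  "upper_Aikawa \<mu> E \<alpha> \<longleftrightarrow>
     (\<forall>\<epsilon>>0. \<exists>\<delta>>0. \<forall>z\<in>E. \<forall>R. admissible_radius E R \<longrightarrow>
        (\<forall>K\<in>sets borel.
           emeasure \<mu> (ball z R - K) \<le> ennreal \<delta> * emeasure \<mu> (ball z R) \<longrightarrow>
           ennreal (R powr (- \<alpha>) / \<epsilon>) \<le>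
             (\<integral>\<^sup>+ y\<in>ball z R. indicator K y * inverse (ennreal (infdist y E powr \<alpha>)) \<partial>\<mu>)
               / emeasure \<mu> (ball z R)))"

primrec truncation_step :: "'a::metric_space set \<Rightarrow> 'a \<Rightarrow> real \<Rightarrow> nat \<Rightarrow> 'a set" where
  "truncation_step E z r 0 = E \<inter> closure (ball z (r / 2))"
| "truncation_step E z r (Suc j) =
     (\<Union>x\<in>truncation_step E z r j. E \<inter> closure (ball x (r / 2 ^ (Suc j + 1))))"

definition truncation :: "'a::metric_space set \<Rightarrow> 'a \<Rightarrow> real \<Rightarrow> 'a set" where
  "truncation E z r = closure (\<Union>j. truncation_step E z r j)"

definition hardy_integral ::
  "'a::metric_space measure \<Rightarrow> real \<Rightarrow> real \<Rightarrow> 'a set \<Rightarrow> 'a set \<Rightarrow> ('a \<Rightarrow> real) \<Rightarrow> ennreal" where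
  "hardy_integral \<mu> s p F A u =
     (\<integral>\<^sup>+ x\<in>A - F. ennreal (\<bar>u x\<bar> powr p) / ennreal (infdist x F powr (s * p)) \<partial>\<mu>)"

definition fractional_energy ::
  "'a::metric_space measure \<Rightarrow> real \<Rightarrow> real \<Rightarrow> 'a set \<Rightarrow> ('a \<Rightarrow> real) \<Rightarrow> ennreal" where
  "fractional_energy \<mu> s p A u =
     (\<integral>\<^sup>+ x\<in>A. (\<integral>\<^sup>+ y\<in>A.
        (if x = y then 0
         else ennreal (\<bar>u x - u y\<bar> powr p) /
              (ennreal (dist x y powr (s * p)) * emeasure \<mu> (ball x (dist x y)))) \<partial>\<mu>) \<partial>\<mu>)"

end

theory Submission
  imports Defs
begin

text \<open>
  Let \<open>F\<close> be the truncation, \<open>D x = dist(x, F)\<close>, \<open>\<alpha> = sq\<close> and \<open>\<Omega> = B(z, 8r)\<close>.  Near every \<open>x \<in> \<Omega> - F\<close> there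
  is a ball \<open>B \<subseteq> \<Omega>\<close> of radius \<open>D x / 64\<close> centred in \<open>E\<close> on which \<open>dist(\<cdot>, E) = D\<close>.  Averaging
  \<open>|u x|\<^sup>p \<le> 2\<^sup>p (|u y|\<^sup>p + |u x - u y|\<^sup>p)\<close> over \<open>y \<in> B\<close> against \<open>D y powr -\<alpha>\<close>, cut off near \<open>F\<close>, the upper
  Aikawa condition bounds \<open>|u x|\<^sup>p D x powr -sp\<close> by \<open>\<epsilon>\<close> times an average of \<open>|u y|\<^sup>p D y powr -\<alpha>\<close>
  with weight \<open>D x powr (\<alpha> - sp)\<close>, plus a multiple of the inner energy integral at \<open>x\<close>.  Since \<open>\<alpha> < sp\<close>,
  integrating the weight in \<open>x\<close> for fixed \<open>y\<close> gives a geometric series dominated by \<open>D y powr (\<alpha> - sp)\<close>,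
  so the first term is at most \<open>C\<epsilon>\<close> times the Hardy integral itself.  That integral is finite because
  \<open>u\<close> is Lipschitz and \<open>s < 1\<close>, so for small \<open>\<epsilon>\<close> the term can be absorbed.
\<close>

section \<open>Inequalities for integrals, extended reals, powers and distances\<close>

lemma ball_subset_ball:
  fixes x y :: "'a::metric_space"
  assumes "dist y x + r \<le> t"
  shows "ball x r \<subseteq> ball y t"
proof
  fix w assume "w \<in> ball x r"
  then show "w \<in> ball y t" using assms dist_triangle[of y w x] by simp
qed

text \<open>Additivity is applied only to the measurable functions \<open>g\<close> and
  \<open>f - g\<close>, and \<open>f - g\<close> lies below \<open>k * h\<close>; so
  \<open>h\<close> may be an energy integrand whose measurability has not been established.
  Finiteness of \<open>f\<close> excludes \<open>\<infinity> - \<infinity>\<close>, which is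
  \<open>\<infinity>\<close>.\<close>

lemma nn_integral_le_add_cmult:
  fixes f g h :: "'a \<Rightarrow> ennreal"
  assumes [measurable]: "f \<in> borel_measurable M" "g \<in> borel_measurable M"
    and k: "0 < k"
    and fin: "\<And>x. f x < \<infinity>"
    and le: "\<And>x. x \<in> space M \<Longrightarrow> f x \<le> g x + ennreal k * h x"
  shows "(\<integral>\<^sup>+x. f x \<partial>M) \<le> (\<integral>\<^sup>+x. g x \<partial>M) + ennreal k * (\<integral>\<^sup>+x. h x \<partial>M)"
proof -
  have inv: "ennreal k * (ennreal (1 / k) * x) = x" "ennreal (1 / k) * (ennreal k * x) = x" for x
    using k by (simp_all flip: mult.assoc ennreal_mult)
  have "f x \<le> g x + (f x - g x)" for x
    using linear[of "f x" "g x"] by (auto simp: add_diff_self_ennreal)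
  then have "(\<integral>\<^sup>+x. f x \<partial>M) \<le> (\<integral>\<^sup>+x. g x + (f x - g x) \<partial>M)"
    by (intro nn_integral_mono) auto
  also have "\<dots> = (\<integral>\<^sup>+x. g x \<partial>M) + (\<integral>\<^sup>+x. ennreal k * (ennreal (1 / k) * (f x - g x)) \<partial>M)"
    by (simp add: nn_integral_add inv)
  also have "\<dots> = (\<integral>\<^sup>+x. g x \<partial>M) + ennreal k * (\<integral>\<^sup>+x. ennreal (1 / k) * (f x - g x) \<partial>M)"
    by (subst nn_integral_cmult) auto
  also have "\<dots> \<le> (\<integral>\<^sup>+x. g x \<partial>M) + ennreal k * (\<integral>\<^sup>+x. h x \<partial>M)"
  proof (intro add_left_mono mult_left_mono nn_integral_mono)
    fix x assume x: "x \<in> space M"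
    have "f x - g x \<le> ennreal k * h x"
      using le[OF x] fin[of x] by (subst ennreal_minus_le_iff) auto
    then have "ennreal (1 / k) * (f x - g x) \<le> ennreal (1 / k) * (ennreal k * h x)"
      by (intro mult_left_mono) auto
    then show "ennreal (1 / k) * (f x - g x) \<le> h x" by (simp add: inv)
  qed auto
  finally show ?thesis .
qed

text \<open>Half of \<open>H\<close> can be moved to the left because \<open>H\<close> is finite;
  for \<open>H = \<infinity>\<close> the first hypothesis would carry no information.\<close>

lemma ennreal_absorb_half:
  fixes H X :: ennreal
  assumes "H \<le> ennreal (1 / 2) * H + X" "H < \<infinity>"
  shows "H \<le> 2 * X"
proof (cases X rule: ennreal_cases)
  case (real x)
  obtain h where h: "H = ennreal h" "0 \<le> h" using assms(2) by (cases H rule: ennreal_cases) auto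
  have "ennreal (1 / 2) * ennreal h + ennreal x = ennreal (1 / 2 * h + x)"
    using h real by (subst ennreal_mult[symmetric]) auto
  then have "ennreal h \<le> ennreal (1 / 2 * h + x)"
    using assms(1) h real by (simp only:)
  then have "h \<le> 1 / 2 * h + x" using h real by (subst (asm) ennreal_le_iff) auto
  then have "h \<le> 2 * x" by simp
  then have "ennreal h \<le> ennreal (2 * x)" by (rule ennreal_leI)
  then show ?thesis using h real by (simp add: ennreal_mult)
qed (simp add: ennreal_mult_top)

lemma ennreal_scale_add:
  fixes X Y :: ennreal
  assumes "0 \<le> t" "0 \<le> a" "0 \<le> b"
  shows "ennreal t * (ennreal a * X + ennreal b * Y) = ennreal (t * a) * X + ennreal (t * b) * Y"
  using assms by (simp add: ennreal_mult distrib_left mult.assoc)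

lemma powr_triangle_le:
  fixes a b p :: real
  assumes "0 \<le> p"
  shows "\<bar>a\<bar> powr p \<le> 2 powr p * (\<bar>b\<bar> powr p + \<bar>a - b\<bar> powr p)"
proof -
  have "\<bar>a\<bar> powr p \<le> (2 * max \<bar>b\<bar> \<bar>a - b\<bar>) powr p"
    using assms abs_triangle_ineq[of b "a - b"] by (intro powr_mono2) (auto simp: max_def)
  also have "\<dots> = 2 powr p * max \<bar>b\<bar> \<bar>a - b\<bar> powr p" by (simp add: powr_mult)
  also have "\<dots> \<le> 2 powr p * (\<bar>b\<bar> powr p + \<bar>a - b\<bar> powr p)"
    by (intro mult_left_mono) (auto simp: max_def)
  finally show ?thesis .
qed

lemma ex_dyadic_bracket:
  fixes t :: real
  assumes "1 \<le> t"
  obtains k :: nat where "2 ^ k \<le> t" "t \<le> 2 ^ Suc k"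
proof -
  obtain n :: nat where "t < 2 ^ n" using real_arch_pow[of 2 t] by auto
  then obtain k where "\<forall>i\<le>k. \<not> t < 2 ^ i" "t < 2 ^ Suc k"
    using ex_least_nat_less[of "\<lambda>n. t < 2 ^ n" n] assms by auto
  then show thesis using that[of k] by (simp add: not_less)
qed

lemma infdist_lessE:
  assumes "infdist x A < t" "A \<noteq> {}"
  obtains a where "a \<in> A" "dist x a < t"
proof -
  have "bdd_below (dist x ` A)" by (intro bdd_belowI2[of _ 0]) simp
  then have "\<exists>a\<in>A. dist x a < t"
    using assms by (simp add: infdist_notempty cINF_less_iff)
  then show thesis using that by blast
qed

lemma lipschitz_le_infdist:
  fixes u :: "'a::metric_space \<Rightarrow> real"
  assumes "L-lipschitz_on UNIV u" "F \<noteq> {}" "\<And>w. w \<in> F \<Longrightarrow> u w = 0"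
  shows "\<bar>u x\<bar> \<le> L * infdist x F"
proof -
  have L: "0 \<le> L" using assms(1) by (rule lipschitz_on_nonneg)
  have le: "\<bar>u x\<bar> \<le> L * dist x w" if "w \<in> F" for w
    using lipschitz_onD[OF assms(1), of x w] assms(3)[OF that] by (simp add: dist_real_def)
  show ?thesis
  proof (cases "L = 0")
    case True
    then show ?thesis using le assms(2) by auto
  next
    case False
    then have "\<bar>u x\<bar> / L \<le> infdist x F"
      unfolding infdist_notempty[OF assms(2)] using L le assms(2)
      by (intro cINF_greatest) (simp_all add: divide_le_eq mult.commute)
    then show ?thesis using False L by (simp add: divide_le_eq mult.commute)
  qed
qed

subsection \<open>Truncations\<close>

text \<open>Makes the Aikawa condition available at every scale up to an admissible
  \<open>r\<close>.\<close>

lemma admissible_radius_mono: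
  fixes E :: "'a::metric_space set"
  assumes "admissible_radius E r" "0 < \<rho>" "\<rho> \<le> r"
  shows "admissible_radius E \<rho>"
  unfolding admissible_radius_def
proof
  show "ennreal \<rho> < (if ediam E = 0 then ediam (UNIV :: 'a set) else ediam E)"
    using assms(1) by (intro le_less_trans[OF ennreal_leI[OF assms(3)]]) (simp add: admissible_radius_def)
qed fact

lemma truncation_step_subset: "truncation_step E z r j \<subseteq> E"
  by (cases j) auto

lemma truncation_step_subset_truncation: "truncation_step E z r j \<subseteq> truncation E z r"
  unfolding truncation_def by (rule order_trans[OF _ closure_subset]) (rule UN_upper, rule UNIV_I)

lemma truncation_subset: "closed E \<Longrightarrow> truncation E z r \<subseteq> E"
  unfolding truncation_def by (intro closure_minimal UN_least truncation_step_subset)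

lemma center_in_truncation: "z \<in> E \<Longrightarrow> 0 < r \<Longrightarrow> z \<in> truncation E z r"
  by (rule subsetD[OF truncation_step_subset_truncation[of E z r 0]])
    (use closure_subset[of "ball z (r / 2)"] in \<open>simp add: subset_iff\<close>)

lemma closure_ball_dist: "x \<in> closure (ball w t) \<Longrightarrow> dist w x \<le> t"
  using closure_minimal[OF ball_subset_cball closed_cball, of w t] by (simp add: subset_iff)

text \<open>The radii \<open>r / 2\<close>, \<open>r / 4\<close>, ... of the successive steps form a
  geometric series, of which the tail \<open>r / 2 ^ (j + 1)\<close> is still unspent after step
  \<open>j\<close>.\<close>

lemma truncation_step_dist: "x \<in> truncation_step E z r j \<Longrightarrow> dist z x \<le> r - r / 2 ^ (j + 1)"
proof (induction j arbitrary: x)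
  case 0
  then show ?case using closure_ball_dist[of x z "r / 2"] by simp
next
  case (Suc j)
  then obtain w where w: "w \<in> truncation_step E z r j" "x \<in> closure (ball w (r / 2 ^ (Suc j + 1)))"
    by auto
  have "dist z x \<le> dist z w + dist w x" by (rule dist_triangle)
  also have "\<dots> \<le> (r - r / 2 ^ (j + 1)) + r / 2 ^ (Suc j + 1)"
    using Suc.IH[OF w(1)] closure_ball_dist[OF w(2)] by (rule add_mono)
  finally show ?case by (simp add: field_simps)
qed

text \<open>Step \<open>i + 1\<close> uses exactly this radius, so it collects these points of
  \<open>E\<close>.\<close>

lemma truncation_step_ball_subset:
  assumes "w \<in> truncation_step E z r i"
  shows "E \<inter> ball w (r / 2 ^ (i + 2)) \<subseteq> truncation E z r"
proof -
  have "E \<inter> ball w (r / 2 ^ (i + 2)) \<subseteq> truncation_step E z r (Suc i)"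
    using assms closure_subset[of "ball w (r / 2 ^ (i + 2))"] by (auto intro!: bexI[of _ w])
  then show ?thesis using truncation_step_subset_truncation by blast
qed

text \<open>By the previous lemma, the truncation agrees with \<open>E\<close> on the ball of radius \<open>R / 4\<close> about \<open>w\<close>;
  this is how it inherits the Aikawa condition at every scale \<open>R \<le> r\<close>.\<close>

lemma truncation_step_ancestor:
  assumes "x \<in> truncation_step E z r j" "0 < R" "R \<le> r"
  shows "\<exists>i. \<exists>w\<in>truncation_step E z r i. R \<le> r / 2 ^ i \<and> dist w x \<le> max 0 (R - r / 2 ^ (j + 1))"
  using assms(1)
proof (induction j arbitrary: x)
  case 0
  then show ?case using assms by (intro exI[of _ 0] bexI[of _ x]) auto
next
  case (Suc j)
  show ?case
  proof (cases "R \<le> r / 2 ^ Suc j")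
    case True
    then show ?thesis using Suc.prems by (intro exI[of _ "Suc j"] bexI[of _ x]) auto
  next
    case False
    obtain y where y: "y \<in> truncation_step E z r j" "x \<in> closure (ball y (r / 2 ^ (Suc j + 1)))"
      using Suc.prems by auto
    obtain i w where w: "w \<in> truncation_step E z r i" "R \<le> r / 2 ^ i"
      "dist w y \<le> max 0 (R - r / 2 ^ (j + 1))"
      using Suc.IH[OF y(1)] by blast
    have "dist w x \<le> dist w y + dist y x" by (rule dist_triangle)
    \<comment> \<open>In this case \<open>R\<close> exceeds \<open>r / 2 ^ (j + 1)\<close>, so the
      maximum in the bound for \<open>y\<close> is its second argument.\<close>
    also have "\<dots> \<le> (R - r / 2 ^ (j + 1)) + r / 2 ^ (Suc j + 1)"
      using w(3) closure_ball_dist[OF y(2)] False by auto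
    also have "\<dots> = R - r / 2 ^ (Suc j + 1)" by (simp add: field_simps)
    finally show ?thesis using w by (intro exI[of _ i] bexI[of _ w]) auto
  qed
qed

text \<open>A point of \<open>E\<close> closer to \<open>y\<close> than the truncation is would lie
  within \<open>t / 2 + t / 2\<close> of \<open>w\<close>, and hence would have been collected in
  step \<open>i + 1\<close>.\<close>

lemma infdist_eq_truncation:
  assumes "closed E" "w \<in> truncation_step E z r i" "t \<le> r / 2 ^ (i + 2)" "y \<in> ball w (t / 2)"
  shows "infdist y E = infdist y (truncation E z r)" (is "_ = infdist y ?F")
proof (rule antisym)
  have wF: "w \<in> ?F" and wE: "w \<in> E"
    using assms(2) truncation_step_subset_truncation truncation_step_subset by blast+
  show "infdist y E \<le> infdist y ?F"
    using truncation_subset[OF assms(1)] wF by (intro infdist_mono) auto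
  show "infdist y ?F \<le> infdist y E"
  proof (rule ccontr)
    assume "\<not> ?thesis"
    moreover have "infdist y E < t / 2"
      using infdist_le[OF wE, of y] assms(4) by (simp add: dist_commute)
    ultimately have "infdist y E < min (infdist y ?F) (t / 2)" by simp
    then obtain e where e: "e \<in> E" "dist y e < min (infdist y ?F) (t / 2)"
      using infdist_lessE[of y E] wE by blast
    have "dist w e < t" using dist_triangle[of w e y] e(2) assms(4) by simp
    then have "e \<in> ?F" using truncation_step_ball_subset[OF assms(2)] e(1) assms(3) by auto
    then show False using infdist_le[of e ?F y] e(2) by simp
  qed
qed

text \<open>An almost nearest point of the truncation may enter at so late a step that agreement
  with \<open>E\<close> is known only on a tiny ball around it. Going back to an ancestor at scale
  \<open>D / 8\<close> moves it by at most \<open>D / 8\<close> and gives agreement on a ball of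
  radius comparable to \<open>D\<close>.\<close>

lemma truncation_companion:
  assumes "closed E" "z \<in> E" "0 < r"
    and D: "D = infdist x (truncation E z r)" "0 < D" "D < 8 * r"
  obtains w where "w \<in> E" "dist x w < 3 * D" "ball w (D / 64) \<subseteq> ball z (8 * r)"
    "\<And>y. y \<in> ball w (D / 64) \<Longrightarrow> infdist y E = infdist y (truncation E z r)"
proof -
  let ?F = "truncation E z r"
  have ne: "?F \<noteq> {}" using center_in_truncation assms by blast
  \<comment> \<open>The factor 2 leaves room to pass first to a point \<open>f\<close> of the
    truncation and then to a point \<open>v\<close> of an actual step.\<close>
  have "infdist x ?F < 2 * D" using D by simp
  then obtain f where f: "f \<in> ?F" "dist x f < 2 * D"
    using infdist_lessE[of x ?F] ne by blast
  have "0 < 2 * D - dist x f" using f by simp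
  then obtain v where "v \<in> (\<Union>j. truncation_step E z r j)" "dist v f < 2 * D - dist x f"
    using f(1) unfolding truncation_def closure_approachable by blast
  then obtain j where v: "v \<in> truncation_step E z r j" "dist x v < 2 * D"
    using dist_triangle[of x v f] by (auto simp: dist_commute)
  \<comment> \<open>The scale \<open>D / 8\<close> is at most \<open>r\<close> because
    \<open>D < 8 * r\<close>.\<close>
  obtain i w where w: "w \<in> truncation_step E z r i" "D / 8 \<le> r / 2 ^ i"
      "dist w v \<le> max 0 (D / 8 - r / 2 ^ (j + 1))"
    using truncation_step_ancestor[OF v(1), of "D / 8"] D by auto
  have pos: "0 < r / 2 ^ n" for n using assms(3) by simp
  have "dist w v \<le> D / 8" using w(3) D(2) pos[of "j + 1"] by linarith
  then have 1: "dist x w < 3 * D" using v(2) dist_triangle[of x w v] D(2) by (simp add: dist_commute)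
  have "dist z w \<le> r" using truncation_step_dist[OF w(1)] pos[of "i + 1"] by linarith
  then have 2: "ball w (D / 64) \<subseteq> ball z (8 * r)"
    using D assms(3) by (intro ball_subset_ball) auto
  have "w \<in> E" using w(1) truncation_step_subset by blast
  \<comment> \<open>Since \<open>D / 8 \<le> r / 2 ^ i\<close>, the value \<open>t = D / 32\<close>
    is at most \<open>r / 2 ^ (i + 2)\<close>, and \<open>t / 2\<close> is the radius
    \<open>D / 64\<close>.\<close>
  moreover have "infdist y E = infdist y ?F" if "y \<in> ball w (D / 64)" for y
    using that w(2) by (intro infdist_eq_truncation[OF assms(1) w(1), of "D / 32"]) (auto simp: field_simps)
  ultimately show thesis using that 1 2 by blast
qed

subsection \<open>Doubling measures\<close>

locale doubling_measure =
  fixes \<mu> :: "'a::metric_space measure" and c :: real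
  assumes sets_eq_borel: "sets \<mu> = sets borel"
    and emeasure_ball_pos: "0 < r \<Longrightarrow> 0 < emeasure \<mu> (ball x r)"
    and emeasure_ball_finite: "0 < r \<Longrightarrow> emeasure \<mu> (ball x r) < \<infinity>"
    and c_gt_1: "1 < c"
    and emeasure_ball_double:
      "0 < r \<Longrightarrow> emeasure \<mu> (ball x (2 * r)) \<le> ennreal c * emeasure \<mu> (ball x r)"
begin

definition vol :: "'a \<Rightarrow> real \<Rightarrow> real" where
  "vol x r = measure \<mu> (ball x r)"

lemma ball_in_sets [measurable]: "ball x r \<in> sets \<mu>"
  by (simp add: sets_eq_borel)

lemma space_eq_UNIV [simp]: "space \<mu> = UNIV"
  using sets_eq_imp_space_eq[OF sets_eq_borel] by simp

lemma borel_measurable_continuous: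
  fixes f :: "'a \<Rightarrow> 'b::topological_space"
  assumes "continuous_on UNIV f"
  shows "f \<in> borel_measurable \<mu>"
  using borel_measurable_continuous_onI[OF assms] measurable_cong_sets[OF sets_eq_borel refl]
  by blast

lemma emeasure_ball: "0 < r \<Longrightarrow> emeasure \<mu> (ball x r) = ennreal (vol x r)"
  unfolding vol_def using emeasure_ball_finite[of r x]
  by (simp add: emeasure_eq_ennreal_measure)

lemma vol_pos: "0 < r \<Longrightarrow> 0 < vol x r"
  using emeasure_ball_pos[of r x] by (simp add: emeasure_ball)

lemma vol_mono: "ball x r \<subseteq> ball y t \<Longrightarrow> 0 < r \<Longrightarrow> 0 < t \<Longrightarrow> vol x r \<le> vol y t"
  using emeasure_mono[of "ball x r" "ball y t" \<mu>]
  by (simp add: emeasure_ball vol_pos less_imp_le)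

lemma vol_double: "0 < r \<Longrightarrow> vol x (2 * r) \<le> c * vol x r"
  using emeasure_ball_double[of r x] c_gt_1 vol_pos[of r x]
  by (simp add: emeasure_ball flip: ennreal_mult)

lemma vol_double_pow: "0 < r \<Longrightarrow> vol x (2 ^ n * r) \<le> c ^ n * vol x r"
proof (induction n)
  case (Suc n)
  have "vol x (2 ^ Suc n * r) \<le> c * vol x (2 ^ n * r)"
    using vol_double[of "2 ^ n * r" x] Suc.prems by (simp add: mult.assoc)
  also have "\<dots> \<le> c * (c ^ n * vol x r)"
    using Suc c_gt_1 by (intro mult_left_mono) auto
  finally show ?case by (simp add: mult.assoc)
qed simp

lemma sigma_finite: "sigma_finite_measure \<mu>"
proof
  fix x0 :: 'a
  have "(\<Union>n. ball x0 (real (Suc n))) = UNIV"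
  proof safe
    fix y
    obtain n where "dist x0 y < real n" using reals_Archimedean2 by blast
    then show "y \<in> (\<Union>n. ball x0 (real (Suc n)))" by (intro UN_I[of n]) auto
  qed auto
  then show "\<exists>A. countable A \<and> A \<subseteq> sets \<mu> \<and> \<Union> A = space \<mu> \<and> (\<forall>a\<in>A. emeasure \<mu> a \<noteq> \<infinity>)"
    using emeasure_ball_finite
    by (intro exI[of _ "range (\<lambda>n. ball x0 (real (Suc n)))"]) (auto simp: less_top)
qed

section \<open>Separability of a doubling space and joint measurability\<close>

text \<open>Volume packing: the balls of radius \<open>\<epsilon> / 2\<close> about the points are
  disjoint, lie in one fixed ball of finite volume, and by doubling each has volume at least
  \<open>vol x0 R / c ^ n\<close>.\<close>

lemma separated_card_bound:
  fixes x0 :: 'a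
  assumes "0 < \<epsilon>" "0 < R"
  obtains N :: nat where
    "\<And>S. finite S \<Longrightarrow> S \<subseteq> ball x0 R \<Longrightarrow> (\<And>x y. x \<in> S \<Longrightarrow> y \<in> S \<Longrightarrow> x \<noteq> y \<Longrightarrow> \<epsilon> \<le> dist x y)
      \<Longrightarrow> card S \<le> N"
proof -
  \<comment> \<open>Chosen so that \<open>n\<close> doublings of the ball of radius
    \<open>\<epsilon> / 2\<close> about any point of \<open>S\<close> cover
    \<open>ball x0 R\<close>.\<close>
  obtain n :: nat where "2 * R / (\<epsilon> / 2) < 2 ^ n" using real_arch_pow[of 2] by auto
  then have n: "2 * R \<le> 2 ^ n * (\<epsilon> / 2)" using assms by (simp add: field_simps)
  define V where "V = vol x0 (R + \<epsilon> / 2)"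
  have "card S \<le> nat \<lceil>c ^ n * V / vol x0 R\<rceil>"
    if S: "finite S" "S \<subseteq> ball x0 R" "\<And>x y. x \<in> S \<Longrightarrow> y \<in> S \<Longrightarrow> x \<noteq> y \<Longrightarrow> \<epsilon> \<le> dist x y" for S
  proof -
    have low: "vol x0 R \<le> c ^ n * vol x (\<epsilon> / 2)" if "x \<in> S" for x
    proof -
      have "dist x0 x < R" using that S by auto
      then have "ball x0 R \<subseteq> ball x (2 ^ n * (\<epsilon> / 2))"
        using n by (intro ball_subset_ball) (simp add: dist_commute)
      then have "vol x0 R \<le> vol x (2 ^ n * (\<epsilon> / 2))" using assms by (intro vol_mono) auto
      then show ?thesis using vol_double_pow[of "\<epsilon> / 2" x n] assms by linarith
    qed
    have "disjoint_family_on (\<lambda>x. ball x (\<epsilon> / 2)) S"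
      unfolding disjoint_family_on_def
    proof (intro ballI impI)
      fix x y assume "x \<in> S" "y \<in> S" "x \<noteq> y"
      then have "\<epsilon> \<le> dist x y" by (rule S)
      then show "ball x (\<epsilon> / 2) \<inter> ball y (\<epsilon> / 2) = {}" by (intro disjoint_ballI) auto
    qed
    then have "measure \<mu> (\<Union>x\<in>S. ball x (\<epsilon> / 2)) = (\<Sum>x\<in>S. vol x (\<epsilon> / 2))"
      using S assms emeasure_ball_finite unfolding vol_def
      by (intro measure_finite_Union) (auto simp: less_top)
    moreover have "measure \<mu> (\<Union>x\<in>S. ball x (\<epsilon> / 2)) \<le> V"
      unfolding V_def vol_def
    proof (rule measure_mono_fmeasurable)
      show "(\<Union>x\<in>S. ball x (\<epsilon> / 2)) \<subseteq> ball x0 (R + \<epsilon> / 2)"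
        using S(2) by (intro UN_least ball_subset_ball) (auto simp: dist_commute)
      show "ball x0 (R + \<epsilon> / 2) \<in> fmeasurable \<mu>"
        using assms emeasure_ball_finite[of "R + \<epsilon>/2" x0] by (intro fmeasurableI) auto
    qed (use S in auto)
    ultimately have "(\<Sum>x\<in>S. vol x (\<epsilon> / 2)) \<le> V" by simp
    then have "c ^ n * (\<Sum>x\<in>S. vol x (\<epsilon> / 2)) \<le> c ^ n * V"
      using c_gt_1 by (intro mult_left_mono) auto
    moreover have "real (card S) * vol x0 R \<le> c ^ n * (\<Sum>x\<in>S. vol x (\<epsilon> / 2))"
      using sum_mono[of S "\<lambda>_. vol x0 R", OF low] by (simp add: sum_distrib_left)
    ultimately have "real (card S) \<le> c ^ n * V / vol x0 R"
      using vol_pos[of R x0] assms by (simp add: field_simps)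
    then show ?thesis by linarith
  qed
  then show thesis by (rule that)
qed

text \<open>Separated sets have bounded cardinality, so there is a largest one; a point at distance
  at least \<open>\<epsilon>\<close> from all its members could still be added to it.\<close>

lemma finite_net:
  fixes x0 :: 'a
  assumes "0 < \<epsilon>" "0 < R"
  obtains S where "finite S" "\<And>x. x \<in> ball x0 R \<Longrightarrow> \<exists>y\<in>S. dist x y < \<epsilon>"
proof -
  define P where "P S \<longleftrightarrow> finite S \<and> S \<subseteq> ball x0 R \<and>
    (\<forall>x\<in>S. \<forall>y\<in>S. x \<noteq> y \<longrightarrow> \<epsilon> \<le> dist x y)" for S
  obtain N where N: "\<And>S. P S \<Longrightarrow> card S \<le> N"
    using separated_card_bound[OF assms, of x0] unfolding P_def by metis
  have "P {}" by (simp add: P_def)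
  then obtain S where S: "P S" "\<And>T. P T \<Longrightarrow> card T \<le> card S"
    using ex_has_greatest_nat[of P "{}" card "Suc N"] N by (auto simp: less_Suc_eq_le)
  have "\<exists>y\<in>S. dist x y < \<epsilon>" if x: "x \<in> ball x0 R" for x
  proof (rule ccontr)
    assume "\<not> ?thesis"
    then have far: "\<And>y. y \<in> S \<Longrightarrow> \<epsilon> \<le> dist x y" by force
    then have "x \<notin> S" using assms by force
    moreover have "P (insert x S)" using S(1) x far by (auto simp: P_def dist_commute)
    ultimately show False using S(2)[of "insert x S"] S(1) by (simp add: P_def)
  qed
  then show thesis using that S(1) by (auto simp: P_def)
qed

text \<open>Finite nets of mesh \<open>1 / real (Suc n)\<close> in the balls of radius
  \<open>real (Suc n)\<close> about one point are collected over all \<open>n\<close>.\<close>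

lemma separable:
  obtains S :: "'a set" where "countable S" "\<And>x \<epsilon>. 0 < \<epsilon> \<Longrightarrow> \<exists>y\<in>S. dist x y < \<epsilon>"
proof -
  fix x0 :: 'a
  have "\<exists>S. finite S \<and> (\<forall>x. dist x0 x < real (Suc n) \<longrightarrow> (\<exists>y\<in>S. dist x y < 1 / real (Suc n)))" for n
    by (rule finite_net[of "1 / real (Suc n)" "real (Suc n)" x0]) (auto simp: mem_ball)
  then obtain S where S: "\<And>n. finite (S n)"
    "\<And>n x. dist x0 x < real (Suc n) \<Longrightarrow> \<exists>y\<in>S n. dist x y < 1 / real (Suc n)"
    by metis
  have "\<exists>y\<in>\<Union>(range S). dist x y < \<epsilon>" if "0 < \<epsilon>" for x \<epsilon>
  proof -
    obtain n :: nat where n: "max (dist x0 x) (1 / \<epsilon>) < real n" using reals_Archimedean2 by blast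
    then have "1 < \<epsilon> * real n" using that by (simp add: field_simps)
    then have "1 / real (Suc n) < \<epsilon>" using that by (simp add: field_simps)
    moreover have "dist x0 x < real (Suc n)" using n by simp
    ultimately show ?thesis using S(2)[of x n] by force
  qed
  moreover have "countable (\<Union>(range S))" using countable_finite[OF S(1)] by simp
  ultimately show thesis using that by blast
qed

text \<open>The product \<open>\<sigma>\<close>-algebra may be smaller than the Borel \<open>\<sigma>\<close>-algebra of the product unless the space
  is separable, so this is not an instance of the library rule for \<open>dist\<close>.\<close>

lemma borel_measurable_dist_pair [measurable]:
  "(\<lambda>w. dist (fst w) (snd w)) \<in> borel_measurable (\<mu> \<Otimes>\<^sub>M \<mu>)"
proof (subst borel_measurable_iff_less, safe)
  fix a :: real
  obtain S :: "'a set" where S: "countable S" "\<And>x \<epsilon>. 0 < \<epsilon> \<Longrightarrow> \<exists>y\<in>S. dist x y < \<epsilon>"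
    using separable by blast
  \<comment> \<open>A countable union of rectangles: a point \<open>s\<close> near \<open>x\<close>
    and a rational \<open>q\<close> split the bound \<open>a\<close> into \<open>q\<close> and
    \<open>a - q\<close>.\<close>
  have "{w \<in> space (\<mu> \<Otimes>\<^sub>M \<mu>). dist (fst w) (snd w) < a}
      = (\<Union>s\<in>S. \<Union>q\<in>\<rat>. ball s q \<times> ball s (a - q))"
  proof safe
    fix x y :: 'a assume "dist (fst (x, y)) (snd (x, y)) < a"
    then have d: "0 < (a - dist x y) / 4" by simp
    \<comment> \<open>With a gap of \<open>4 * e\<close>, the triangle inequality gives
      \<open>dist s y < a - 3 * e\<close>, which is below \<open>a - q\<close> for every
      \<open>q < 2 * e\<close>.\<close>
    define e where "e = (a - dist x y) / 4"
    obtain s where s: "s \<in> S" "dist x s < e" using S(2)[OF d] by (auto simp: e_def)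
    obtain q where q: "q \<in> \<rat>" "e < q" "q < 2 * e"
      using Rats_dense_in_real[of e "2 * e"] d by (auto simp: e_def)
    have "dist s y \<le> dist x s + dist x y" by (metis dist_commute dist_triangle)
    then have "dist s y < a - q" using s q by (simp add: e_def)
    then show "(x, y) \<in> (\<Union>s\<in>S. \<Union>q\<in>\<rat>. ball s q \<times> ball s (a - q))"
      using s q by (auto simp: dist_commute intro!: bexI[of _ s] bexI[of _ q])
  next
    fix x y s :: 'a and q assume "x \<in> ball s q" "y \<in> ball s (a - q)"
    then show "dist (fst (x, y)) (snd (x, y)) < a"
      using dist_triangle[of x y s] by (simp add: dist_commute)
  qed (simp add: space_pair_measure)
  also have "\<dots> \<in> sets (\<mu> \<Otimes>\<^sub>M \<mu>)"
    using S(1) countable_rat by (intro sets.countable_UN'' pair_measureI ball_in_sets)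
  finally show "{w \<in> space (\<mu> \<Otimes>\<^sub>M \<mu>). dist (fst w) (snd w) < a} \<in> sets (\<mu> \<Otimes>\<^sub>M \<mu>)" .
qed

text \<open>Balls of measurably varying radius are the sections of one measurable set in the
  product, and section measures are measurable by sigma-finiteness.\<close>

lemma borel_measurable_vol:
  assumes [measurable]: "\<rho> \<in> borel_measurable \<mu>"
  shows "(\<lambda>x. vol x (\<rho> x)) \<in> borel_measurable \<mu>"
proof -
  interpret sigma_finite_measure \<mu> by (rule sigma_finite)
  define Q where "Q = {w \<in> space (\<mu> \<Otimes>\<^sub>M \<mu>). dist (fst w) (snd w) < \<rho> (fst w)}"
  have "Q \<in> sets (\<mu> \<Otimes>\<^sub>M \<mu>)" unfolding Q_def by measurable
  then have meas: "(\<lambda>x. emeasure \<mu> (Pair x -` Q)) \<in> borel_measurable \<mu>"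
    by (rule measurable_emeasure_Pair)
  have "Pair x -` Q = ball x (\<rho> x)" for x
    by (auto simp: Q_def space_pair_measure)
  with meas show ?thesis by (simp add: vol_def measure_def)
qed

subsection \<open>The absorption argument\<close>

text \<open>With \<open>D = infdist x F\<close>, the radius \<open>4 * D\<close> is large enough to
  contain the companion ball of \<open>x\<close>, whose points are within
  \<open>3 * D + D / 64\<close>. The exponent in use is
  \<open>\<beta> = \<sigma> - \<alpha>\<close>. If \<open>D = 0\<close>, the condition fails and the
  kernel vanishes.\<close>

definition weight :: "'a set \<Rightarrow> real \<Rightarrow> 'a \<Rightarrow> 'a \<Rightarrow> real" where
  "weight F \<beta> x y =
     (if dist x y < 4 * infdist x F then infdist x F powr - \<beta> / vol x (4 * infdist x F) else 0)"

lemma weight_nonneg: "0 \<le> weight F \<beta> x y"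
  by (simp add: weight_def vol_def)

lemma borel_measurable_infdist: "(\<lambda>x. infdist x F) \<in> borel_measurable \<mu>"
  by (intro borel_measurable_continuous continuous_intros)

lemma borel_measurable_weight:
  "(\<lambda>w. weight F \<beta> (fst w) (snd w)) \<in> borel_measurable (\<mu> \<Otimes>\<^sub>M \<mu>)"
proof -
  note [measurable] = borel_measurable_infdist[of F] borel_measurable_vol[of "\<lambda>x. 4 * infdist x F"]
  show ?thesis unfolding weight_def by measurable
qed

text \<open>If \<open>x\<close> contributes, then
  \<open>infdist y F \<le> infdist x F + dist x y < 5 * infdist x F\<close>, so
  \<open>infdist x F\<close> is at least \<open>t\<close> and falls into some dyadic range starting
  at \<open>2 ^ k * t\<close>. The term for that \<open>k\<close> alone dominates the
  kernel.\<close>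

lemma weight_le_suminf:
  assumes "0 < \<beta>" "0 < infdist y F"
  defines "t \<equiv> infdist y F / 5"
  shows "ennreal (weight F \<beta> x y) \<le>
    (\<Sum>k. ennreal (c\<^sup>2 * (2 ^ k * t) powr - \<beta> / vol y (8 * (2 ^ k * t))) *
      indicator (ball y (8 * (2 ^ k * t))) x)"
    (is "_ \<le> (\<Sum>k. ?f k)")
proof (cases "dist x y < 4 * infdist x F")
  case True
  let ?d = "infdist x F"
  have t: "0 < t" using assms by simp
  have "5 * t \<le> ?d + dist x y"
    using infdist_triangle[of y F x] by (simp add: t_def dist_commute)
  then have "1 \<le> ?d / t" using True t by (simp add: field_simps)
  then obtain k where "2 ^ k \<le> ?d / t" "?d / t \<le> 2 ^ Suc k"
    by (rule ex_dyadic_bracket)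
  then have k: "2 ^ k * t \<le> ?d" "?d \<le> 2 * (2 ^ k * t)"
    using t by (simp_all add: field_simps)
  define \<tau> where "\<tau> = 2 ^ k * t"
  have \<tau>: "0 < \<tau>" "\<tau> \<le> ?d" "?d \<le> 2 * \<tau>" using k t by (auto simp: \<tau>_def)
  have xy: "dist x y < 8 * \<tau>" using True \<tau> by simp
  \<comment> \<open>From \<open>dist x y < 8 * \<tau>\<close> the ball about \<open>y\<close> lies
    in the ball of radius \<open>16 * \<tau>\<close> about \<open>x\<close>; two doublings compare
    this with radius \<open>4 * \<tau>\<close>.\<close>
  have "vol y (8 * \<tau>) \<le> vol x (2 ^ 2 * (4 * \<tau>))"
    using xy \<tau> by (intro vol_mono ball_subset_ball) auto
  also have "\<dots> \<le> c\<^sup>2 * vol x (4 * \<tau>)" using \<tau> by (intro vol_double_pow) auto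
  also have "\<dots> \<le> c\<^sup>2 * vol x (4 * ?d)"
    using \<tau> c_gt_1 by (intro mult_left_mono vol_mono subset_ball) auto
  finally have vol: "vol y (8 * \<tau>) \<le> c\<^sup>2 * vol x (4 * ?d)" .
  have "?d powr - \<beta> / vol x (4 * ?d) \<le> \<tau> powr - \<beta> / vol x (4 * ?d)"
    using \<tau> assms by (intro divide_right_mono powr_mono2') (auto simp: vol_def)
  also have "\<dots> \<le> \<tau> powr - \<beta> * (c\<^sup>2 / vol y (8 * \<tau>))"
    using vol vol_pos[of "8 * \<tau>" y] vol_pos[of "4 * ?d" x] \<tau>
    unfolding divide_inverse[of "\<tau> powr - \<beta>"]
    by (intro mult_left_mono) (auto simp: field_simps)
  finally have "weight F \<beta> x y \<le> c\<^sup>2 * \<tau> powr - \<beta> / vol y (8 * \<tau>)"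
    using True by (simp add: weight_def mult.commute)
  then have "ennreal (weight F \<beta> x y) \<le> ?f k"
    using xy by (simp add: \<tau>_def dist_commute ennreal_leI)
  also have "\<dots> \<le> (\<Sum>k. ?f k)"
  proof -
    have "f k \<le> suminf f" for f :: "nat \<Rightarrow> ennreal"
      using sum_le_suminf[of f "{k}"] by simp
    then show ?thesis .
  qed
  finally show ?thesis .
qed (simp add: weight_def)

text \<open>The factor \<open>5 powr \<beta>\<close> comes from \<open>t = infdist y F / 5\<close>,
  the denominator from the geometric series with ratio \<open>2 powr - \<beta>\<close>, and the
  square of \<open>c\<close> from changing the centre of a ball.\<close>

definition weight_const :: "real \<Rightarrow> real" where
  "weight_const \<beta> = c\<^sup>2 * 5 powr \<beta> / (1 - 2 powr - \<beta>)"

lemma weight_const_pos: "0 < \<beta> \<Longrightarrow> 0 < weight_const \<beta>"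
  using c_gt_1 powr_less_mono[of "- \<beta>" 0 2] by (simp add: weight_const_def)

text \<open>Integrating a dyadic term cancels its ball volume and leaves a multiple of
  \<open>(2 ^ k * t) powr - \<beta>\<close>. The series converges because
  \<open>\<beta> > 0\<close>, which is where \<open>\<alpha> < \<sigma>\<close> enters.\<close>

lemma nn_integral_weight_le:
  assumes "0 < \<beta>" "0 < infdist y F"
  shows "(\<integral>\<^sup>+x. ennreal (weight F \<beta> x y) \<partial>\<mu>) \<le> ennreal (weight_const \<beta> * infdist y F powr - \<beta>)"
proof -
  define t where "t = infdist y F / 5"
  have t: "0 < t" using assms by (simp add: t_def)
  let ?a = "\<lambda>k. c\<^sup>2 * (2 ^ k * t) powr - \<beta>"
  let ?v = "\<lambda>k. vol y (8 * (2 ^ k * t))"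
  have v: "0 < ?v k" for k using t by (intro vol_pos) auto
  have "(\<integral>\<^sup>+x. ennreal (weight F \<beta> x y) \<partial>\<mu>) \<le>
      (\<integral>\<^sup>+x. (\<Sum>k. ennreal (?a k / ?v k) * indicator (ball y (8 * (2 ^ k * t))) x) \<partial>\<mu>)"
    using weight_le_suminf[OF assms] by (intro nn_integral_mono) (simp add: t_def)
  also have "\<dots> = (\<Sum>k. \<integral>\<^sup>+x. ennreal (?a k / ?v k) * indicator (ball y (8 * (2 ^ k * t))) x \<partial>\<mu>)"
    by (intro nn_integral_suminf) auto
  also have "\<dots> = (\<Sum>k. ennreal (?a k))"
  proof (intro suminf_cong)
    fix k
    have "(\<integral>\<^sup>+x. ennreal (?a k / ?v k) * indicator (ball y (8 * (2 ^ k * t))) x \<partial>\<mu>)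
        = ennreal (?a k / ?v k) * ennreal (?v k)"
      using t by (simp add: nn_integral_cmult_indicator emeasure_ball)
    also have "\<dots> = ennreal (?a k)"
      using v[of k] by (subst ennreal_mult[symmetric]) auto
    finally show "(\<integral>\<^sup>+x. ennreal (?a k / ?v k) * indicator (ball y (8 * (2 ^ k * t))) x \<partial>\<mu>)
        = ennreal (?a k)" .
  qed
  also have "\<dots> = ennreal (weight_const \<beta> * infdist y F powr - \<beta>)"
  proof (intro suminf_ennreal_eq)
    have "(\<lambda>k. (2 powr - \<beta>) ^ k) sums (1 / (1 - 2 powr - \<beta>))"
      using powr_less_mono[of "- \<beta>" 0 2] assms by (intro geometric_sums) simp
    then have "(\<lambda>k. c\<^sup>2 * t powr - \<beta> * (2 powr - \<beta>) ^ k) sums (c\<^sup>2 * t powr - \<beta> * (1 / (1 - 2 powr - \<beta>)))"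
      by (rule sums_mult)
    moreover have "?a = (\<lambda>k. c\<^sup>2 * t powr - \<beta> * (2 powr - \<beta>) ^ k)"
    proof
      fix k
      have "(2 ^ k) powr - \<beta> = (2 powr - \<beta>) ^ k"
        by (simp add: powr_realpow[symmetric] powr_powr mult.commute)
      then show "?a k = c\<^sup>2 * t powr - \<beta> * (2 powr - \<beta>) ^ k" using t by (simp add: powr_mult)
    qed
    moreover have "c\<^sup>2 * t powr - \<beta> * (1 / (1 - 2 powr - \<beta>)) = weight_const \<beta> * infdist y F powr - \<beta>"
      using assms by (simp add: weight_const_def t_def powr_divide powr_minus field_simps)
    ultimately show "?a sums (weight_const \<beta> * infdist y F powr - \<beta>)" by (simp only:)
  qed auto
  finally show ?thesis .
qed

text \<open>After exchanging the integrals, the kernel bound applies at each \<open>y\<close> with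
  \<open>infdist y F > 0\<close>; elsewhere \<open>v y = 0\<close>.\<close>

lemma nn_integral_weight_Fubini:
  fixes v :: "'a \<Rightarrow> real"
  assumes "0 < \<beta>" and [measurable]: "v \<in> borel_measurable \<mu>"
    and v: "\<And>y. 0 \<le> v y" "\<And>y. infdist y F = 0 \<Longrightarrow> v y = 0"
  shows "(\<integral>\<^sup>+x. \<integral>\<^sup>+y. ennreal (v y * weight F \<beta> x y) \<partial>\<mu> \<partial>\<mu>)
    \<le> ennreal (weight_const \<beta>) * (\<integral>\<^sup>+y. ennreal (v y * infdist y F powr - \<beta>) \<partial>\<mu>)"
proof -
  interpret sigma_finite_measure \<mu> by (rule sigma_finite)
  interpret pair_sigma_finite \<mu> \<mu> ..
  note [measurable] = borel_measurable_weight[of F \<beta>] borel_measurable_infdist[of F]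
  have meas [measurable]: "(\<lambda>w. ennreal (v (snd w) * weight F \<beta> (fst w) (snd w))) \<in> borel_measurable (\<mu> \<Otimes>\<^sub>M \<mu>)"
    by measurable
  have "(\<integral>\<^sup>+x. \<integral>\<^sup>+y. ennreal (v y * weight F \<beta> x y) \<partial>\<mu> \<partial>\<mu>)
      = (\<integral>\<^sup>+y. \<integral>\<^sup>+x. ennreal (v y * weight F \<beta> x y) \<partial>\<mu> \<partial>\<mu>)"
    using meas by (intro Fubini'[symmetric]) (simp add: case_prod_beta')
  also have "\<dots> \<le> (\<integral>\<^sup>+y. ennreal (weight_const \<beta>) * ennreal (v y * infdist y F powr - \<beta>) \<partial>\<mu>)"
  proof (intro nn_integral_mono)
    fix y
    have [measurable]: "(\<lambda>x. weight F \<beta> x y) \<in> borel_measurable \<mu>"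
      using measurable_compose[OF measurable_Pair2'[of y \<mu> \<mu>] borel_measurable_weight] by simp
    show "(\<integral>\<^sup>+x. ennreal (v y * weight F \<beta> x y) \<partial>\<mu>)
        \<le> ennreal (weight_const \<beta>) * ennreal (v y * infdist y F powr - \<beta>)"
    proof (cases "infdist y F = 0")
      case False
      then have d: "0 < infdist y F" using infdist_nonneg[of y F] by linarith
      have "(\<integral>\<^sup>+x. ennreal (v y * weight F \<beta> x y) \<partial>\<mu>) = ennreal (v y) * (\<integral>\<^sup>+x. ennreal (weight F \<beta> x y) \<partial>\<mu>)"
        using v by (simp add: ennreal_mult' weight_nonneg nn_integral_cmult)
      also have "\<dots> \<le> ennreal (v y) * ennreal (weight_const \<beta> * infdist y F powr - \<beta>)"
        using nn_integral_weight_le[OF assms(1) d] by (intro mult_left_mono) auto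
      also have "\<dots> = ennreal (weight_const \<beta>) * ennreal (v y * infdist y F powr - \<beta>)"
        using v weight_const_pos[OF assms(1)]
        by (subst (1 2) ennreal_mult[symmetric]) (auto simp: mult_ac)
      finally show ?thesis .
    qed (simp add: v)
  qed
  also have "\<dots> = ennreal (weight_const \<beta>) * (\<integral>\<^sup>+y. ennreal (v y * infdist y F powr - \<beta>) \<partial>\<mu>)"
    by (intro nn_integral_cmult) measurable
  finally show ?thesis .
qed

text \<open>The set \<open>K\<close> is the ball minus the \<open>\<eta>\<rho>\<close>-neighbourhood of \<open>E\<close>.  Either \<open>K\<close> is admissible in the
  Aikawa condition, or that neighbourhood fills a fraction \<open>\<delta>\<close> of the ball; as \<open>\<eta>\<^sup>\<alpha> = \<delta>\<epsilon>\<close>,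
  both cases give the same bound.\<close>

lemma Aikawa_average_bound:
  fixes u :: "'a \<Rightarrow> real" and a :: real
  assumes "0 < \<alpha>" "0 < p" "0 < \<epsilon>" "0 < \<delta>" "0 < \<rho>"
    and Aikawa: "\<And>K. K \<in> sets borel \<Longrightarrow> emeasure \<mu> (ball w \<rho> - K) \<le> ennreal \<delta> * emeasure \<mu> (ball w \<rho>) \<Longrightarrow>
      ennreal (\<rho> powr - \<alpha> / \<epsilon>) \<le>
        (\<integral>\<^sup>+y\<in>ball w \<rho>. indicator K y * inverse (ennreal (infdist y E powr \<alpha>)) \<partial>\<mu>) / emeasure \<mu> (ball w \<rho>)"
    and [measurable]: "u \<in> borel_measurable \<mu>"
    and zero: "\<And>y. y \<in> ball w \<rho> \<Longrightarrow> infdist y E = 0 \<Longrightarrow> u y = 0"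
  shows "ennreal (\<bar>a\<bar> powr p * vol w \<rho>) \<le>
    ennreal (2 powr p * \<epsilon> * \<rho> powr \<alpha>) * (\<integral>\<^sup>+y\<in>ball w \<rho>. ennreal (\<bar>u y\<bar> powr p * infdist y E powr - \<alpha>) \<partial>\<mu>)
    + ennreal (2 powr p / \<delta>) * (\<integral>\<^sup>+y\<in>ball w \<rho>. ennreal (\<bar>a - u y\<bar> powr p) \<partial>\<mu>)"
proof -
  let ?B = "ball w \<rho>" and ?D = "\<lambda>y. infdist y E"
  let ?I = "\<integral>\<^sup>+y\<in>?B. ennreal (\<bar>u y\<bar> powr p * ?D y powr - \<alpha>) \<partial>\<mu>"
  let ?J = "\<integral>\<^sup>+y\<in>?B. ennreal (\<bar>a - u y\<bar> powr p) \<partial>\<mu>"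
  note [measurable] = borel_measurable_infdist[of E]
  define \<eta> where "\<eta> = (\<delta> * \<epsilon>) powr (1 / \<alpha>)"
  have \<eta>: "0 < \<eta>" "\<eta> powr \<alpha> = \<delta> * \<epsilon>" using assms by (simp_all add: \<eta>_def powr_powr)
  \<comment> \<open>Both cases end alike. The density \<open>k\<close> has mass at least
    \<open>t * vol w \<rho>\<close> on the ball; \<open>k_u\<close> controls it against
    \<open>u\<close>, and \<open>k_le\<close> against the difference \<open>a - u y\<close>.
    Integrating the triangle inequality times \<open>k\<close> and dividing by \<open>t\<close>
    gives the claim.\<close>
  have core: ?thesis
    if t: "0 < t" and k [measurable]: "k \<in> borel_measurable \<mu>"
      and k_nonneg: "\<And>y. 0 \<le> k y"
      and large: "ennreal (t * vol w \<rho>) \<le> (\<integral>\<^sup>+y\<in>?B. ennreal (k y) \<partial>\<mu>)"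
      and k_u: "\<And>y. y \<in> ?B \<Longrightarrow> k y * \<bar>u y\<bar> powr p \<le> t * \<epsilon> * \<rho> powr \<alpha> * (\<bar>u y\<bar> powr p * ?D y powr - \<alpha>)"
      and k_le: "\<And>y. y \<in> ?B \<Longrightarrow> k y \<le> t / \<delta>"
    for t k
  proof -
    have le: "\<bar>a\<bar> powr p * k y \<le> t * (2 powr p * \<epsilon> * \<rho> powr \<alpha>) * (\<bar>u y\<bar> powr p * ?D y powr - \<alpha>)
        + t * (2 powr p / \<delta>) * \<bar>a - u y\<bar> powr p" if y: "y \<in> ?B" for y
    proof -
      have "\<bar>a\<bar> powr p * k y \<le> 2 powr p * (\<bar>u y\<bar> powr p + \<bar>a - u y\<bar> powr p) * k y"
        using powr_triangle_le[of p a "u y"] assms k_nonneg by (intro mult_right_mono) auto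
      also have "\<dots> = 2 powr p * (k y * \<bar>u y\<bar> powr p) + 2 powr p * (k y * \<bar>a - u y\<bar> powr p)"
        by (simp add: algebra_simps)
      also have "\<dots> \<le> 2 powr p * (t * \<epsilon> * \<rho> powr \<alpha> * (\<bar>u y\<bar> powr p * ?D y powr - \<alpha>))
          + 2 powr p * (t / \<delta> * \<bar>a - u y\<bar> powr p)"
        using k_u[OF y] k_le[OF y] by (intro add_mono mult_left_mono mult_right_mono) auto
      finally show ?thesis by (simp add: mult_ac)
    qed
    have "ennreal t * ennreal (\<bar>a\<bar> powr p * vol w \<rho>) = ennreal (\<bar>a\<bar> powr p) * ennreal (t * vol w \<rho>)"
      using t vol_pos[OF \<open>0 < \<rho>\<close>, of w] by (simp add: mult_ac flip: ennreal_mult)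
    also have "\<dots> \<le> ennreal (\<bar>a\<bar> powr p) * (\<integral>\<^sup>+y\<in>?B. ennreal (k y) \<partial>\<mu>)"
      using large by (intro mult_left_mono) auto
    also have "\<dots> = (\<integral>\<^sup>+y. ennreal (\<bar>a\<bar> powr p) * (ennreal (k y) * indicator ?B y) \<partial>\<mu>)"
      by (intro nn_integral_cmult[symmetric]) measurable
    also have "\<dots> \<le> (\<integral>\<^sup>+y. ennreal (t * (2 powr p * \<epsilon> * \<rho> powr \<alpha>)) * (ennreal (\<bar>u y\<bar> powr p * ?D y powr - \<alpha>) * indicator ?B y)
        + ennreal (t * (2 powr p / \<delta>)) * (ennreal (\<bar>a - u y\<bar> powr p) * indicator ?B y) \<partial>\<mu>)"
    proof (intro nn_integral_mono)
      fix y
      show "ennreal (\<bar>a\<bar> powr p) * (ennreal (k y) * indicator ?B y)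
        \<le> ennreal (t * (2 powr p * \<epsilon> * \<rho> powr \<alpha>)) * (ennreal (\<bar>u y\<bar> powr p * ?D y powr - \<alpha>) * indicator ?B y)
        + ennreal (t * (2 powr p / \<delta>)) * (ennreal (\<bar>a - u y\<bar> powr p) * indicator ?B y)"
      proof (cases "y \<in> ?B")
        case True
        have "ennreal (\<bar>a\<bar> powr p * k y) \<le> ennreal (t * (2 powr p * \<epsilon> * \<rho> powr \<alpha>) * (\<bar>u y\<bar> powr p * ?D y powr - \<alpha>)
            + t * (2 powr p / \<delta>) * \<bar>a - u y\<bar> powr p)"
          using le[OF True] by (rule ennreal_leI)
        also have "\<dots> = ennreal (t * (2 powr p * \<epsilon> * \<rho> powr \<alpha>)) * ennreal (\<bar>u y\<bar> powr p * ?D y powr - \<alpha>)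
            + ennreal (t * (2 powr p / \<delta>)) * ennreal (\<bar>a - u y\<bar> powr p)"
        proof -
          have lin: "ennreal (a' * b' + c' * d') = ennreal a' * ennreal b' + ennreal c' * ennreal d'"
            if "0 \<le> a'" "0 \<le> b'" "0 \<le> c'" "0 \<le> d'" for a' b' c' d' :: real
            using that by (simp add: ennreal_mult)
          show ?thesis by (rule lin) (use t assms in simp_all)
        qed
        finally show ?thesis using True k_nonneg by (simp add: ennreal_mult)
      qed simp
    qed
    also have "\<dots> = ennreal (t * (2 powr p * \<epsilon> * \<rho> powr \<alpha>)) * ?I + ennreal (t * (2 powr p / \<delta>)) * ?J"
      by (subst nn_integral_add, measurable, intro arg_cong2[where f = plus] nn_integral_cmult) measurable
    also have "\<dots> = ennreal t * (ennreal (2 powr p * \<epsilon> * \<rho> powr \<alpha>) * ?I + ennreal (2 powr p / \<delta>) * ?J)"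
      using t assms by (intro ennreal_scale_add[symmetric]) simp_all
    finally have "ennreal (1 / t) * (ennreal t * ennreal (\<bar>a\<bar> powr p * vol w \<rho>)) \<le>
        ennreal (1 / t) * (ennreal t * (ennreal (2 powr p * \<epsilon> * \<rho> powr \<alpha>) * ?I + ennreal (2 powr p / \<delta>) * ?J))"
      by (rule mult_left_mono) simp
    moreover have "ennreal (1 / t) * (ennreal t * X) = X" for X
      using t by (simp flip: mult.assoc ennreal_mult)
    ultimately show ?thesis by simp
  qed
  define K where "K = {y. \<eta> * \<rho> \<le> ?D y}"
  have K: "K \<in> sets borel"
    unfolding K_def by (intro borel_closed closed_Collect_le continuous_intros)
  then have [measurable]: "K \<in> sets \<mu>" by (simp add: sets_eq_borel)
  have \<eta>\<rho>: "0 < \<eta> * \<rho>" using \<eta> assms by simp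
  show ?thesis
  proof (cases "emeasure \<mu> (?B - K) \<le> ennreal \<delta> * emeasure \<mu> ?B")
    case True
    define k where "k y = (if y \<in> K then ?D y powr - \<alpha> else 0)" for y
    \<comment> \<open>On \<open>K\<close> the distance is at least
      \<open>\<eta> * \<rho> > 0\<close>, so the extended inverse is finite there and equals the
      real power.\<close>
    have k_eq: "ennreal (k y) = indicator K y * inverse (ennreal (?D y powr \<alpha>))" for y
      using \<eta>\<rho> by (auto simp: k_def K_def powr_minus inverse_ennreal)
    show ?thesis
    proof (rule core)
      show "0 < \<rho> powr - \<alpha> / \<epsilon>" using assms by simp
      show "k \<in> borel_measurable \<mu>" unfolding k_def by measurable
      show "0 \<le> k y" for y by (simp add: k_def)
      have "ennreal (\<rho> powr - \<alpha> / \<epsilon>) * ennreal (vol w \<rho>) \<le> (\<integral>\<^sup>+y\<in>?B. ennreal (k y) \<partial>\<mu>) / ennreal (vol w \<rho>) * ennreal (vol w \<rho>)"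
        using Aikawa[OF K True] assms by (intro mult_right_mono) (auto simp: k_eq emeasure_ball)
      also have "\<dots> = (\<integral>\<^sup>+y\<in>?B. ennreal (k y) \<partial>\<mu>)"
        using vol_pos[OF \<open>0 < \<rho>\<close>, of w]
        by (simp add: divide_ennreal_def mult.assoc inverse_ennreal flip: ennreal_mult)
      finally show "ennreal (\<rho> powr - \<alpha> / \<epsilon> * vol w \<rho>) \<le> (\<integral>\<^sup>+y\<in>?B. ennreal (k y) \<partial>\<mu>)"
        using \<open>0 < \<epsilon>\<close> vol_pos[OF \<open>0 < \<rho>\<close>, of w] by (subst ennreal_mult) auto
      show "k y * \<bar>u y\<bar> powr p \<le> \<rho> powr - \<alpha> / \<epsilon> * \<epsilon> * \<rho> powr \<alpha> * (\<bar>u y\<bar> powr p * ?D y powr - \<alpha>)" for y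
        using assms by (simp add: k_def powr_minus)
      show "k y \<le> \<rho> powr - \<alpha> / \<epsilon> / \<delta>" for y
      proof (cases "y \<in> K")
        case True
        then have "?D y powr - \<alpha> \<le> (\<eta> * \<rho>) powr - \<alpha>"
          using \<eta>\<rho> assms by (intro powr_mono2') (auto simp: K_def)
        also have "\<dots> = \<rho> powr - \<alpha> / \<epsilon> / \<delta>"
          using \<eta> assms by (simp add: powr_mult powr_minus field_simps)
        finally show ?thesis using True by (simp add: k_def)
      qed (use assms in \<open>simp add: k_def\<close>)
    qed
  next
    case False
    \<comment> \<open>Now the part of the ball outside \<open>K\<close> has measure at least
      \<open>\<delta> * vol w \<rho>\<close>, so a plain average over it suffices. There
      \<open>?D y \<le> \<eta> * \<rho>\<close>, which makes \<open>1\<close> at most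
      \<open>\<delta> * \<epsilon> * \<rho> powr \<alpha> * ?D y powr - \<alpha>\<close> wherever
      \<open>?D y > 0\<close>.\<close>
    define k where "k y = (if y \<in> K then 0 else 1 :: real)" for y
    show ?thesis
    proof (rule core)
      show "0 < \<delta>" by fact
      show "k \<in> borel_measurable \<mu>" unfolding k_def by measurable
      show "0 \<le> k y" for y by (simp add: k_def)
      have "ennreal (\<delta> * vol w \<rho>) \<le> emeasure \<mu> (?B - K)"
        using False assms vol_pos[OF \<open>0 < \<rho>\<close>, of w] by (simp add: emeasure_ball ennreal_mult)
      also have "\<dots> = (\<integral>\<^sup>+y. indicator (?B - K) y \<partial>\<mu>)" by simp
      also have "\<dots> = (\<integral>\<^sup>+y\<in>?B. ennreal (k y) \<partial>\<mu>)"
        by (intro nn_integral_cong) (auto simp: k_def indicator_def)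
      finally show "ennreal (\<delta> * vol w \<rho>) \<le> (\<integral>\<^sup>+y\<in>?B. ennreal (k y) \<partial>\<mu>)" .
      show "k y \<le> \<delta> / \<delta>" for y using assms by (simp add: k_def)
      show "k y * \<bar>u y\<bar> powr p \<le> \<delta> * \<epsilon> * \<rho> powr \<alpha> * (\<bar>u y\<bar> powr p * ?D y powr - \<alpha>)" if y: "y \<in> ?B" for y
      proof (cases "y \<in> K \<or> ?D y = 0")
        \<comment> \<open>Where \<open>?D y = 0\<close> the right side is 0 because
          \<open>0 powr - \<alpha> = 0\<close>; the inequality holds since
          \<open>u y = 0\<close>.\<close>
        case True
        then show ?thesis using zero[OF y] assms by (auto simp: k_def)
      next
        case False
        then have D: "0 < ?D y" "?D y \<le> \<eta> * \<rho>" using infdist_nonneg[of y E] by (auto simp: K_def)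
        have "1 = ?D y powr \<alpha> * ?D y powr - \<alpha>" using D by (simp add: powr_minus)
        also have "\<dots> \<le> (\<eta> * \<rho>) powr \<alpha> * ?D y powr - \<alpha>"
          using D assms by (intro mult_right_mono powr_mono2) auto
        also have "\<dots> = \<delta> * \<epsilon> * \<rho> powr \<alpha> * ?D y powr - \<alpha>"
          using \<eta> assms by (simp add: powr_mult)
        finally have "\<bar>u y\<bar> powr p * 1 \<le> \<bar>u y\<bar> powr p * (\<delta> * \<epsilon> * \<rho> powr \<alpha> * ?D y powr - \<alpha>)"
          by (intro mult_left_mono) auto
        then show ?thesis using False by (simp add: k_def mult_ac)
      qed
    qed
  qed
qed

section \<open>From the pointwise estimate to the Hardy inequality\<close>

text \<open>The average bound on the companion ball, multiplied by
  \<open>D powr - \<sigma> / vol w \<rho>\<close>, has the right shape: doubling and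
  \<open>\<rho> \<le> D\<close> turn its first term into an integral against \<open>weight\<close>,
  and \<open>dist x y < 4 * D\<close> turns its second into the inner energy integral.\<close>

lemma hardy_pointwise:
  fixes u :: "'a \<Rightarrow> real"
  assumes "closed E" "z \<in> E" "0 < r"
    and pos: "0 < \<alpha>" "0 < p" "0 < \<sigma>" "0 < \<epsilon>" "0 < \<delta>"
    and Aikawa: "\<And>w \<rho> K. w \<in> E \<Longrightarrow> 0 < \<rho> \<Longrightarrow> \<rho> \<le> r \<Longrightarrow> K \<in> sets borel \<Longrightarrow>
      emeasure \<mu> (ball w \<rho> - K) \<le> ennreal \<delta> * emeasure \<mu> (ball w \<rho>) \<Longrightarrow>
      ennreal (\<rho> powr - \<alpha> / \<epsilon>) \<le>
        (\<integral>\<^sup>+y\<in>ball w \<rho>. indicator K y * inverse (ennreal (infdist y E powr \<alpha>)) \<partial>\<mu>) / emeasure \<mu> (ball w \<rho>)"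
    and u [measurable]: "u \<in> borel_measurable \<mu>"
    and zero: "\<And>y. y \<in> truncation E z r \<Longrightarrow> u y = 0"
    and x: "x \<in> ball z (8 * r)"
  defines "F \<equiv> truncation E z r"
  shows "ennreal (\<bar>u x\<bar> powr p * infdist x F powr - \<sigma>) \<le>
    ennreal (2 powr p * c ^ 9 * \<epsilon>) *
      (\<integral>\<^sup>+y. ennreal (\<bar>u y\<bar> powr p * infdist y F powr - \<alpha> * indicator (ball z (8 * r)) y
        * weight F (\<sigma> - \<alpha>) x y) \<partial>\<mu>)
    + ennreal (2 powr p * c ^ 9 * 4 powr \<sigma> / \<delta>) *
      (\<integral>\<^sup>+y\<in>ball z (8 * r). (if x = y then 0 else ennreal (\<bar>u x - u y\<bar> powr p) /
        (ennreal (dist x y powr \<sigma>) * emeasure \<mu> (ball x (dist x y)))) \<partial>\<mu>)"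
proof (cases "infdist x F = 0")
  case False
  define D where "D = infdist x F"
  define \<rho> where "\<rho> = D / 64"
  let ?\<Omega> = "ball z (8 * r)"
  let ?g = "\<lambda>y. \<bar>u y\<bar> powr p * infdist y F powr - \<alpha>"
  note [measurable] = borel_measurable_infdist
  have D: "0 < D" using False infdist_nonneg[of x F] by (simp add: D_def)
  have zF: "z \<in> F" using center_in_truncation assms by (simp add: F_def)
  have "D \<le> dist x z" using infdist_le[OF zF] by (simp add: D_def)
  then have D8: "D < 8 * r" using x by (simp add: dist_commute)
  obtain w where w: "w \<in> E" "dist x w < 3 * D" "ball w \<rho> \<subseteq> ?\<Omega>"
    "\<And>y. y \<in> ball w \<rho> \<Longrightarrow> infdist y E = infdist y F"
    using truncation_companion[OF assms(1-3) D_def[unfolded F_def] D D8] unfolding \<rho>_def F_def by blast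
  have \<rho>: "0 < \<rho>" "\<rho> \<le> r" "\<rho> \<le> D" using D D8 by (auto simp: \<rho>_def)
  let ?B = "ball w \<rho>"
  have B_near: "dist x y < 4 * D" if "y \<in> ?B" for y
    using that w(2) dist_triangle[of x y w] \<rho>_def D by simp
  \<comment> \<open>The radius \<open>2 ^ 9 * \<rho>\<close> is \<open>8 * D\<close>, which exceeds
    \<open>3 * D + 4 * D\<close>; this is the source of \<open>c ^ 9\<close>.\<close>
  have "vol x (4 * D) \<le> vol w (2 ^ 9 * \<rho>)"
    using w(2) D \<rho> by (intro vol_mono ball_subset_ball) (auto simp: \<rho>_def dist_commute)
  also have "\<dots> \<le> c ^ 9 * vol w \<rho>" using \<rho> by (intro vol_double_pow)
  finally have vol: "vol x (4 * D) \<le> c ^ 9 * vol w \<rho>" .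
  have vpos: "0 < vol x (4 * D)" "0 < vol w \<rho>" using D \<rho> by (auto intro: vol_pos)
  have inv_vol: "1 / vol w \<rho> \<le> c ^ 9 / vol x (4 * D)" using vol vpos by (simp add: field_simps)
  define q where "q = D powr - \<sigma> / vol w \<rho>"
  have q: "0 < q" using D vpos by (simp add: q_def)
  define I where "I = (\<integral>\<^sup>+y\<in>?B. ennreal (?g y) \<partial>\<mu>)"
  define J where "J = (\<integral>\<^sup>+y\<in>?B. ennreal (\<bar>u x - u y\<bar> powr p) \<partial>\<mu>)"
  have "closed F" by (simp add: F_def truncation_def)
  then have u0: "u y = 0" if "infdist y F = 0" for y
    using that zero zF in_closed_iff_infdist_zero[of F y] by (auto simp: F_def)
  \<comment> \<open>The average bound is stated with the distance to \<open>E\<close>; on the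
    companion ball this is the distance to \<open>F\<close>, which also supplies the zeros of
    \<open>u\<close>.\<close>
  have "ennreal (\<bar>u x\<bar> powr p * vol w \<rho>) \<le>
    ennreal (2 powr p * \<epsilon> * \<rho> powr \<alpha>) * (\<integral>\<^sup>+y\<in>?B. ennreal (\<bar>u y\<bar> powr p * infdist y E powr - \<alpha>) \<partial>\<mu>)
    + ennreal (2 powr p / \<delta>) * J"
    unfolding J_def
    by (rule Aikawa_average_bound)
      (fact pos \<rho> u | (rule Aikawa[OF w(1) \<rho>(1,2)]; assumption) | (rule u0, simp add: w(4)[symmetric]))+
  also have "(\<integral>\<^sup>+y\<in>?B. ennreal (\<bar>u y\<bar> powr p * infdist y E powr - \<alpha>) \<partial>\<mu>) = I"
    unfolding I_def using w(4) by (intro nn_integral_cong) (simp add: indicator_def)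
  finally have "ennreal q * ennreal (\<bar>u x\<bar> powr p * vol w \<rho>) \<le>
      ennreal q * (ennreal (2 powr p * \<epsilon> * \<rho> powr \<alpha>) * I + ennreal (2 powr p / \<delta>) * J)"
    by (rule mult_left_mono) simp
  also have "\<dots> = ennreal (q * (2 powr p * \<epsilon> * \<rho> powr \<alpha>)) * I + ennreal (q * (2 powr p / \<delta>)) * J"
    using q pos by (intro ennreal_scale_add) auto
  finally have "ennreal (\<bar>u x\<bar> powr p * D powr - \<sigma>) \<le>
      ennreal (q * (2 powr p * \<epsilon> * \<rho> powr \<alpha>)) * I + ennreal (q * (2 powr p / \<delta>)) * J"
    using q vpos by (simp add: q_def mult.commute flip: ennreal_mult)
  also have "\<dots> \<le> ennreal (2 powr p * c ^ 9 * \<epsilon>) *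
      (\<integral>\<^sup>+y. ennreal (?g y * indicator ?\<Omega> y * weight F (\<sigma> - \<alpha>) x y) \<partial>\<mu>)
    + ennreal (2 powr p * c ^ 9 * 4 powr \<sigma> / \<delta>) *
      (\<integral>\<^sup>+y\<in>?\<Omega>. (if x = y then 0 else ennreal (\<bar>u x - u y\<bar> powr p) /
        (ennreal (dist x y powr \<sigma>) * emeasure \<mu> (ball x (dist x y)))) \<partial>\<mu>)"
  proof (rule add_mono)
    have "q * (2 powr p * \<epsilon> * \<rho> powr \<alpha>) \<le> (D powr - \<sigma> * (c ^ 9 / vol x (4 * D))) * (2 powr p * \<epsilon> * D powr \<alpha>)"
      unfolding q_def divide_inverse[of "D powr - \<sigma>"] using inv_vol \<rho> pos c_gt_1
      by (intro mult_mono mult_left_mono powr_mono2) (auto simp: inverse_eq_divide vol_def)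
    also have "\<dots> = 2 powr p * c ^ 9 * \<epsilon> * (D powr - (\<sigma> - \<alpha>) / vol x (4 * D))"
      by (simp add: powr_diff powr_minus field_simps)
    finally have coeff: "q * (2 powr p * \<epsilon> * \<rho> powr \<alpha>) \<le> 2 powr p * c ^ 9 * \<epsilon> * (D powr - (\<sigma> - \<alpha>) / vol x (4 * D))" .
    have "ennreal (q * (2 powr p * \<epsilon> * \<rho> powr \<alpha>)) * I
        = (\<integral>\<^sup>+y. ennreal (q * (2 powr p * \<epsilon> * \<rho> powr \<alpha>)) * (ennreal (?g y) * indicator ?B y) \<partial>\<mu>)"
      unfolding I_def by (intro nn_integral_cmult[symmetric]) measurable
    \<comment> \<open>Taking \<open>g = 0\<close> pulls the constant out of the integral by
      comparison alone; the energy term below is treated in the same way.\<close>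
    also have "\<dots> \<le> (\<integral>\<^sup>+y. 0 \<partial>\<mu>) + ennreal (2 powr p * c ^ 9 * \<epsilon>) *
        (\<integral>\<^sup>+y. ennreal (?g y * indicator ?\<Omega> y * weight F (\<sigma> - \<alpha>) x y) \<partial>\<mu>)"
    proof (rule nn_integral_le_add_cmult)
      show "0 < 2 powr p * c ^ 9 * \<epsilon>" using pos c_gt_1 by simp
      fix y
      show "ennreal (q * (2 powr p * \<epsilon> * \<rho> powr \<alpha>)) * (ennreal (?g y) * indicator ?B y) \<le>
        0 + ennreal (2 powr p * c ^ 9 * \<epsilon>) * ennreal (?g y * indicator ?\<Omega> y * weight F (\<sigma> - \<alpha>) x y)"
      proof (cases "y \<in> ?B")
        case True
        have W: "weight F (\<sigma> - \<alpha>) x y = D powr - (\<sigma> - \<alpha>) / vol x (4 * D)"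
          using B_near[OF True] by (simp add: weight_def D_def)
        have "q * (2 powr p * \<epsilon> * \<rho> powr \<alpha>) * ?g y \<le>
            2 powr p * c ^ 9 * \<epsilon> * weight F (\<sigma> - \<alpha>) x y * ?g y"
          unfolding W using coeff by (intro mult_right_mono) auto
        also have "\<dots> = 2 powr p * c ^ 9 * \<epsilon> * (?g y * weight F (\<sigma> - \<alpha>) x y)" by (simp only: mult_ac)
        finally have "ennreal (q * (2 powr p * \<epsilon> * \<rho> powr \<alpha>) * ?g y) \<le>
            ennreal (2 powr p * c ^ 9 * \<epsilon> * (?g y * weight F (\<sigma> - \<alpha>) x y))"
          by (rule ennreal_leI)
        moreover have "y \<in> ?\<Omega>" using True w(3) by blast
        ultimately show ?thesis using True q pos c_gt_1
          by (subst (asm) (1 2) ennreal_mult) (auto simp: weight_nonneg)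
      qed simp
    qed (measurable, measurable, simp add: indicator_def ennreal_mult_less_top)
    finally show "ennreal (q * (2 powr p * \<epsilon> * \<rho> powr \<alpha>)) * I \<le> ennreal (2 powr p * c ^ 9 * \<epsilon>) *
        (\<integral>\<^sup>+y. ennreal (?g y * indicator ?\<Omega> y * weight F (\<sigma> - \<alpha>) x y) \<partial>\<mu>)"
      by simp
  next
    let ?k = "\<lambda>y. if x = y then 0 else ennreal (\<bar>u x - u y\<bar> powr p) /
        (ennreal (dist x y powr \<sigma>) * emeasure \<mu> (ball x (dist x y)))"
    have "ennreal (q * (2 powr p / \<delta>)) * J
        = (\<integral>\<^sup>+y. ennreal (q * (2 powr p / \<delta>)) * (ennreal (\<bar>u x - u y\<bar> powr p) * indicator ?B y) \<partial>\<mu>)"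
      unfolding J_def by (intro nn_integral_cmult[symmetric]) measurable
    also have "\<dots> \<le> (\<integral>\<^sup>+y. 0 \<partial>\<mu>) + ennreal (2 powr p * c ^ 9 * 4 powr \<sigma> / \<delta>) * (\<integral>\<^sup>+y. ?k y * indicator ?\<Omega> y \<partial>\<mu>)"
    proof (rule nn_integral_le_add_cmult)
      show "0 < 2 powr p * c ^ 9 * 4 powr \<sigma> / \<delta>" using pos c_gt_1 by simp
      fix y
      show "ennreal (q * (2 powr p / \<delta>)) * (ennreal (\<bar>u x - u y\<bar> powr p) * indicator ?B y) \<le>
        0 + ennreal (2 powr p * c ^ 9 * 4 powr \<sigma> / \<delta>) * (?k y * indicator ?\<Omega> y)"
      proof (cases "y \<in> ?B \<and> x \<noteq> y")
        case True
        let ?d = "dist x y"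
        \<comment> \<open>\<open>?d \<le> 4 * D\<close> is used twice: for
          \<open>D powr - \<sigma>\<close>, at the price of \<open>4 powr \<sigma>\<close>, and for
          the inclusion of \<open>ball x ?d\<close> in \<open>ball x (4 * D)\<close>.\<close>
        have d: "0 < ?d" "?d \<le> 4 * D" using True B_near[of y] by auto
        have vd: "0 < vol x ?d" using d by (intro vol_pos)
        have "D powr - \<sigma> = 4 powr \<sigma> * (4 * D) powr - \<sigma>" using D by (simp add: powr_mult powr_minus)
        also have "\<dots> \<le> 4 powr \<sigma> * ?d powr - \<sigma>"
          using d pos by (intro mult_left_mono powr_mono2') auto
        finally have 1: "D powr - \<sigma> \<le> 4 powr \<sigma> * ?d powr - \<sigma>" .
        have "c ^ 9 / vol x (4 * D) \<le> c ^ 9 / vol x ?d"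
          using d D vd c_gt_1 by (intro divide_left_mono vol_mono subset_ball mult_pos_pos vol_pos) auto
        then have 2: "1 / vol w \<rho> \<le> c ^ 9 / vol x ?d" using inv_vol by linarith
        have "q = D powr - \<sigma> * (1 / vol w \<rho>)" by (simp add: q_def)
        also have "\<dots> \<le> 4 powr \<sigma> * ?d powr - \<sigma> * (c ^ 9 / vol x ?d)"
          using 1 2 vpos by (intro mult_mono) auto
        finally have "q * (2 powr p / \<delta>) * \<bar>u x - u y\<bar> powr p \<le>
            4 powr \<sigma> * ?d powr - \<sigma> * (c ^ 9 / vol x ?d) * (2 powr p / \<delta>) * \<bar>u x - u y\<bar> powr p"
          using pos by (intro mult_right_mono) auto
        also have "\<dots> = 2 powr p * c ^ 9 * 4 powr \<sigma> / \<delta> * (\<bar>u x - u y\<bar> powr p / (?d powr \<sigma> * vol x ?d))"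
          by (simp add: powr_minus field_simps)
        finally have "ennreal (q * (2 powr p / \<delta>) * \<bar>u x - u y\<bar> powr p) \<le>
            ennreal (2 powr p * c ^ 9 * 4 powr \<sigma> / \<delta> * (\<bar>u x - u y\<bar> powr p / (?d powr \<sigma> * vol x ?d)))"
          by (rule ennreal_leI)
        also have "\<dots> = ennreal (2 powr p * c ^ 9 * 4 powr \<sigma> / \<delta>) * ennreal (\<bar>u x - u y\<bar> powr p / (?d powr \<sigma> * vol x ?d))"
          using pos c_gt_1 vd by (intro ennreal_mult) auto
        also have "ennreal (\<bar>u x - u y\<bar> powr p / (?d powr \<sigma> * vol x ?d)) = ?k y"
          using True d vd by (simp add: emeasure_ball divide_ennreal flip: ennreal_mult)
        finally have "ennreal (q * (2 powr p / \<delta>) * \<bar>u x - u y\<bar> powr p) \<le>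
            ennreal (2 powr p * c ^ 9 * 4 powr \<sigma> / \<delta>) * ?k y" .
        moreover have "y \<in> ?\<Omega>" using True w(3) by blast
        ultimately show ?thesis using True q pos by (subst (asm) ennreal_mult) auto
      qed auto
    qed (measurable, measurable, simp add: indicator_def ennreal_mult_less_top)
    finally show "ennreal (q * (2 powr p / \<delta>)) * J \<le>
        ennreal (2 powr p * c ^ 9 * 4 powr \<sigma> / \<delta>) * (\<integral>\<^sup>+y. ?k y * indicator ?\<Omega> y \<partial>\<mu>)"
      by simp
  qed
  finally show ?thesis by (simp add: D_def)
qed simp

text \<open>Integrating the pointwise bound over the ball gives \<open>H\<close> at most a multiple
  of \<open>\<epsilon> * H\<close> plus energy. The value of \<open>\<epsilon>\<close> makes that
  multiple exactly \<open>1 / 2\<close>, and \<open>H\<close> is finite, so it can be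
  absorbed.\<close>

lemma hardy_inequality:
  fixes u :: "'a \<Rightarrow> real"
  assumes "closed E" "z \<in> E" "0 < r"
    and pos: "0 < \<alpha>" "\<alpha> < s * p" "0 < p" "s < 1" "0 < \<delta>"
  defines "\<epsilon> \<equiv> 1 / (2 * (2 powr p * c ^ 9) * weight_const (s * p - \<alpha>))"
  assumes Aikawa: "\<And>w \<rho> K. w \<in> E \<Longrightarrow> 0 < \<rho> \<Longrightarrow> \<rho> \<le> r \<Longrightarrow> K \<in> sets borel \<Longrightarrow>
      emeasure \<mu> (ball w \<rho> - K) \<le> ennreal \<delta> * emeasure \<mu> (ball w \<rho>) \<Longrightarrow>
      ennreal (\<rho> powr - \<alpha> / \<epsilon>) \<le>
        (\<integral>\<^sup>+y\<in>ball w \<rho>. indicator K y * inverse (ennreal (infdist y E powr \<alpha>)) \<partial>\<mu>) / emeasure \<mu> (ball w \<rho>)"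
    and u: "L-lipschitz_on UNIV u"
    and zero: "\<And>y. y \<in> truncation E z r \<Longrightarrow> u y = 0"
  shows "hardy_integral \<mu> s p (truncation E z r) (ball z (8 * r)) u
    \<le> ennreal (2 * (2 powr p * c ^ 9 * 4 powr (s * p) / \<delta>)) * fractional_energy \<mu> s p (ball z (8 * r)) u"
proof -
  define F where "F = truncation E z r"
  define \<sigma> where "\<sigma> = s * p"
  define M where "M = 2 powr p * c ^ 9"
  let ?\<Omega> = "ball z (8 * r)"
  \<comment> \<open>As \<open>0 powr a = 0\<close>, this vanishes on \<open>F\<close>.\<close>
  let ?h = "\<lambda>x. \<bar>u x\<bar> powr p * infdist x F powr - \<sigma>"
  let ?v = "\<lambda>y. \<bar>u y\<bar> powr p * infdist y F powr - \<alpha> * indicator ?\<Omega> y"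
  define H where "H = (\<integral>\<^sup>+x\<in>?\<Omega>. ennreal (?h x) \<partial>\<mu>)"
  let ?G = "\<lambda>x. \<integral>\<^sup>+y\<in>?\<Omega>. (if x = y then 0 else ennreal (\<bar>u x - u y\<bar> powr p) /
        (ennreal (dist x y powr \<sigma>) * emeasure \<mu> (ball x (dist x y)))) \<partial>\<mu>"
  have \<sigma>: "0 < \<sigma>" "\<alpha> < \<sigma>" "\<sigma> < p" using pos by (auto simp: \<sigma>_def)
  have M: "0 < M" using c_gt_1 by (simp add: M_def)
  have wc: "0 < weight_const (\<sigma> - \<alpha>)" using \<sigma> by (intro weight_const_pos) simp
  then have \<epsilon>: "0 < \<epsilon>" "M * \<epsilon> * weight_const (\<sigma> - \<alpha>) = 1 / 2"
    using M by (simp_all add: \<epsilon>_def flip: M_def \<sigma>_def)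
  have meas [measurable]: "u \<in> borel_measurable \<mu>"
    using lipschitz_on_continuous_on[OF u] by (rule borel_measurable_continuous)
  note [measurable] = borel_measurable_infdist
  have zF: "z \<in> F" using center_in_truncation assms by (simp add: F_def)
  have closed: "closed F" by (simp add: F_def truncation_def)
  have "hardy_integral \<mu> s p F ?\<Omega> u = H"
    unfolding hardy_integral_def H_def
  proof (intro nn_integral_cong)
    fix x
    show "ennreal (\<bar>u x\<bar> powr p) / ennreal (infdist x F powr (s * p)) * indicator (?\<Omega> - F) x
        = ennreal (?h x) * indicator ?\<Omega> x"
    proof (cases "x \<in> F")
      case False
      then have "0 < infdist x F"
        using closed zF infdist_pos_not_in_closed[of F x] by auto
      then have "ennreal (\<bar>u x\<bar> powr p) / ennreal (infdist x F powr (s * p)) = ennreal (?h x)"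
        by (simp add: divide_ennreal powr_minus divide_inverse \<sigma>_def)
      then show ?thesis using False by (simp add: indicator_def)
    qed simp
  qed
  moreover have "H \<le> 2 * (ennreal (M * 4 powr \<sigma> / \<delta>) * (\<integral>\<^sup>+x\<in>?\<Omega>. ?G x \<partial>\<mu>))"
  proof (rule ennreal_absorb_half)
    let ?A = "\<lambda>x. ennreal (M * \<epsilon>) * (\<integral>\<^sup>+y. ennreal (?v y * weight F (\<sigma> - \<alpha>) x y) \<partial>\<mu>)"
    have [measurable]: "(\<lambda>x. \<integral>\<^sup>+y. ennreal (?v y * weight F (\<sigma> - \<alpha>) x y) \<partial>\<mu>) \<in> borel_measurable \<mu>"
    proof -
      interpret sigma_finite_measure \<mu> by (rule sigma_finite)
      note [measurable] = borel_measurable_weight[of F "\<sigma> - \<alpha>"]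
      have "(\<lambda>w. ennreal (?v (snd w) * weight F (\<sigma> - \<alpha>) (fst w) (snd w))) \<in> borel_measurable (\<mu> \<Otimes>\<^sub>M \<mu>)"
        by measurable
      then show ?thesis by (intro borel_measurable_nn_integral) (simp add: case_prod_beta')
    qed
    have "H \<le> (\<integral>\<^sup>+x. ?A x \<partial>\<mu>) + ennreal (M * 4 powr \<sigma> / \<delta>) * (\<integral>\<^sup>+x\<in>?\<Omega>. ?G x \<partial>\<mu>)"
      unfolding H_def
    proof (rule nn_integral_le_add_cmult)
      show "0 < M * 4 powr \<sigma> / \<delta>" using M pos by simp
      fix x
      show "ennreal (?h x) * indicator ?\<Omega> x \<le> ?A x + ennreal (M * 4 powr \<sigma> / \<delta>) * (?G x * indicator ?\<Omega> x)"
      proof (cases "x \<in> ?\<Omega>")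
        case True
        have "ennreal (?h x) \<le> ?A x + ennreal (M * 4 powr \<sigma> / \<delta>) * ?G x"
          unfolding F_def M_def
          by (rule hardy_pointwise)
            (fact assms(1-3) pos \<sigma>(1) \<epsilon>(1) meas True | (rule Aikawa; assumption) | (rule zero; assumption))+
        then show ?thesis using True by simp
      qed simp
    qed (measurable, measurable, simp add: indicator_def)
    \<comment> \<open>Exchanging the integrals replaces the kernel by
      \<open>infdist y F powr - (\<sigma> - \<alpha>)\<close>; with the factor
      \<open>infdist y F powr - \<alpha>\<close> in \<open>?v\<close> this restores the exponent of
      \<open>H\<close>.\<close>
    also have "(\<integral>\<^sup>+x. ?A x \<partial>\<mu>) \<le> ennreal (1 / 2) * H"
    proof -
      have "(\<integral>\<^sup>+x. ?A x \<partial>\<mu>)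
          = ennreal (M * \<epsilon>) * (\<integral>\<^sup>+x. \<integral>\<^sup>+y. ennreal (?v y * weight F (\<sigma> - \<alpha>) x y) \<partial>\<mu> \<partial>\<mu>)"
        by (intro nn_integral_cmult) measurable
      also have "\<dots> \<le> ennreal (M * \<epsilon>) * (ennreal (weight_const (\<sigma> - \<alpha>)) *
          (\<integral>\<^sup>+y. ennreal (?v y * infdist y F powr - (\<sigma> - \<alpha>)) \<partial>\<mu>))"
        using \<sigma> by (intro mult_left_mono nn_integral_weight_Fubini) auto
      also have "\<dots> = ennreal (1 / 2) * (\<integral>\<^sup>+y. ennreal (?v y * infdist y F powr - (\<sigma> - \<alpha>)) \<partial>\<mu>)"
        using \<epsilon> M wc by (simp only: mult.assoc[symmetric] ennreal_mult[symmetric] less_imp_le mult_pos_pos)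
      also have "(\<integral>\<^sup>+y. ennreal (?v y * infdist y F powr - (\<sigma> - \<alpha>)) \<partial>\<mu>) = H"
        unfolding H_def
      proof (intro nn_integral_cong)
        fix y
        have "infdist y F powr - \<alpha> * infdist y F powr - (\<sigma> - \<alpha>) = infdist y F powr - \<sigma>"
          by (simp flip: powr_add)
        then show "ennreal (?v y * infdist y F powr - (\<sigma> - \<alpha>)) = ennreal (?h y) * indicator ?\<Omega> y"
          by (simp add: indicator_def mult.assoc)
      qed
      finally show ?thesis .
    qed
    finally show "H \<le> ennreal (1 / 2) * H + ennreal (M * 4 powr \<sigma> / \<delta>) * (\<integral>\<^sup>+x\<in>?\<Omega>. ?G x \<partial>\<mu>)"
      by (simp add: add_right_mono)
    \<comment> \<open>Finiteness: \<open>\<bar>u x\<bar> \<le> L * infdist x F\<close> bounds the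
      integrand by a multiple of \<open>infdist x F powr (p - \<sigma>)\<close>. The exponent is
      positive because \<open>s < 1\<close>, and \<open>infdist x F < 8 * r\<close> because
      \<open>z\<close> lies in \<open>F\<close>.\<close>
    have "H \<le> (\<integral>\<^sup>+x. ennreal (L powr p * (8 * r) powr (p - \<sigma>)) * indicator ?\<Omega> x \<partial>\<mu>)"
      unfolding H_def
    proof (intro nn_integral_mono)
      fix x
      show "ennreal (?h x) * indicator ?\<Omega> x \<le> ennreal (L powr p * (8 * r) powr (p - \<sigma>)) * indicator ?\<Omega> x"
      proof (cases "x \<in> ?\<Omega>")
        case True
        have L: "0 \<le> L" using u by (rule lipschitz_on_nonneg)
        have "\<bar>u x\<bar> \<le> L * infdist x F"
          using zF zero by (intro lipschitz_le_infdist[OF u]) (auto simp: F_def)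
        then have "\<bar>u x\<bar> powr p \<le> (L * infdist x F) powr p" using pos by (intro powr_mono2) auto
        then have "?h x \<le> (L * infdist x F) powr p * infdist x F powr - \<sigma>"
          by (rule mult_right_mono) simp
        also have "\<dots> = L powr p * infdist x F powr (p - \<sigma>)"
          using L infdist_nonneg[of x F] by (simp add: powr_mult mult.assoc flip: powr_add)
        also have "\<dots> \<le> L powr p * (8 * r) powr (p - \<sigma>)"
          using \<sigma> True infdist_le[OF zF, of x] infdist_nonneg[of x F]
          by (intro mult_left_mono powr_mono2) (auto simp: dist_commute)
        finally show ?thesis using True by (simp add: ennreal_leI)
      qed simp
    qed
    also have "\<dots> < \<infinity>"
      using emeasure_ball_finite[of "8 * r" z] \<open>0 < r\<close>
      by (simp add: nn_integral_cmult_indicator ennreal_mult_less_top)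
    finally show "H < \<infinity>" .
  qed
  moreover have "fractional_energy \<mu> s p ?\<Omega> u = (\<integral>\<^sup>+x\<in>?\<Omega>. ?G x \<partial>\<mu>)"
    unfolding fractional_energy_def \<sigma>_def ..
  moreover have "ennreal (2 * (M * 4 powr \<sigma> / \<delta>)) = 2 * ennreal (M * 4 powr \<sigma> / \<delta>)"
    using M pos by (subst ennreal_mult) auto
  ultimately show ?thesis
    by (simp only: F_def M_def \<sigma>_def mult.assoc)
qed

end

theorem theorem4p2:
  fixes \<mu> :: "'a::metric_space measure"
    and p q s :: real
    and E :: "'a set"
  assumes "metric_measure_space \<mu>"
    and "doubling \<mu>"
    and "1 < q" and "q < p"
    and "0 < s" and "s < 1"
    and "E \<noteq> {}" and "closed E"
    and "upper_Aikawa \<mu> E (s * q)"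
  shows "\<exists>C::real. C > 0 \<and>
    (\<forall>z\<in>E. \<forall>r. admissible_radius E r \<longrightarrow>
      (\<forall>u::'a \<Rightarrow> real.
        (\<exists>L. L-lipschitz_on UNIV u) \<and> (\<forall>x\<in>truncation E z r. u x = 0) \<longrightarrow>
        hardy_integral \<mu> s p (truncation E z r) (ball z (8 * r)) u
          \<le> ennreal C * fractional_energy \<mu> s p (ball z (8 * r)) u))"
proof -
  obtain c where c: "c > 1"
    "\<And>x r. 0 < r \<Longrightarrow> emeasure \<mu> (ball x (2 * r)) \<le> ennreal c * emeasure \<mu> (ball x r)"
    using assms(2) unfolding doubling_def by blast
  have \<mu>: "sets \<mu> = sets borel"
    "\<And>x r. 0 < r \<Longrightarrow> 0 < emeasure \<mu> (ball x r)" "\<And>x r. 0 < r \<Longrightarrow> emeasure \<mu> (ball x r) < \<infinity>"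
    using assms(1) unfolding metric_measure_space_def by blast+
  interpret doubling_measure \<mu> c
    by unfold_locales (fact \<mu>(1) c(1) | (rule \<mu>(2,3) c(2); assumption))+
  define \<alpha> where "\<alpha> = s * q"
  \<comment> \<open>This depends only on \<open>c\<close>, \<open>p\<close>, \<open>s\<close> and
    \<open>q\<close>, so \<open>\<delta>\<close> and the final constant are fixed before
    \<open>z\<close>, \<open>r\<close> and \<open>u\<close> are chosen.\<close>
  define \<epsilon> where "\<epsilon> = 1 / (2 * (2 powr p * c ^ 9) * weight_const (s * p - \<alpha>))"
  have \<alpha>: "0 < \<alpha>" "\<alpha> < s * p" "0 < p" using assms(3-6) by (simp_all add: \<alpha>_def)
  then have \<epsilon>: "0 < \<epsilon>" using weight_const_pos[of "s * p - \<alpha>"] c_gt_1 by (simp add: \<epsilon>_def)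
  obtain \<delta> where \<delta>: "0 < \<delta>" and Aikawa:
    "\<And>w \<rho> K. w \<in> E \<Longrightarrow> admissible_radius E \<rho> \<Longrightarrow> K \<in> sets borel \<Longrightarrow>
      emeasure \<mu> (ball w \<rho> - K) \<le> ennreal \<delta> * emeasure \<mu> (ball w \<rho>) \<Longrightarrow>
      ennreal (\<rho> powr - \<alpha> / \<epsilon>) \<le>
        (\<integral>\<^sup>+y\<in>ball w \<rho>. indicator K y * inverse (ennreal (infdist y E powr \<alpha>)) \<partial>\<mu>) / emeasure \<mu> (ball w \<rho>)"
    using assms(9)[folded \<alpha>_def, unfolded upper_Aikawa_def, rule_format, OF \<epsilon>]
  proof (elim exE conjE, goal_cases)
    case (1 \<delta>)
    show thesis by (rule that[OF 1(2)]) (rule 1(3)[rule_format]; assumption)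
  qed
  show ?thesis
  proof (intro exI conjI ballI allI impI)
    show "0 < 2 * (2 powr p * c ^ 9 * 4 powr (s * p) / \<delta>)" using c_gt_1 \<delta> by simp
    fix z r and u :: "'a \<Rightarrow> real"
    assume z: "z \<in> E" and r: "admissible_radius E r"
      and "(\<exists>L. L-lipschitz_on UNIV u) \<and> (\<forall>x\<in>truncation E z r. u x = 0)"
    then obtain L where u: "L-lipschitz_on UNIV u" "\<And>x. x \<in> truncation E z r \<Longrightarrow> u x = 0" by blast
    have "0 < r" using r by (simp add: admissible_radius_def)
    then show "hardy_integral \<mu> s p (truncation E z r) (ball z (8 * r)) u
        \<le> ennreal (2 * (2 powr p * c ^ 9 * 4 powr (s * p) / \<delta>)) * fractional_energy \<mu> s p (ball z (8 * r)) u"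
      by (intro hardy_inequality[OF assms(8) z _ \<alpha> assms(6) \<delta> _ u, folded \<epsilon>_def] Aikawa
          admissible_radius_mono[OF r])
  qed
qed

end
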